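(* Let $n\geq 2$. The logic action of $\mathrm{Aut}(\mathbf{D}_n)$ on $\mathcal{R}_n$ is the universal minimal flow of $\mathrm{Aut}(\mathbf{D}_n)$.
   Context: Fix $n\geq 2$ and a set $D_n\subseteq\mathbb{Q}^n$ which is dense in $\mathbb{Q}^n$ (product topology) and such that no two distinct points of $D_n$ share a common coordinate. $\mathbf{D}_n=(D_n,<)$ where $<$ is the product order ($\mathbf{a}<\mathbf{b}$ iff $a_i\leq b_i$ for all $i$ and $\mathbf{a}\neq\mathbf{b}$); $\mathrm{Aut}(\mathbf{D}_n)$ is its automorphism group with the topology of pointwise convergence. $\mathcal{R}_n$ is the set of all $n$-tuples $(\prec_1,\ldots,\prec_n)$ of strict linear orders on $D_n$ with $<\;=\;\prec_1\cap\cdots\cap\prec_n$ (with the topology inherited from $(\{0,1\}^{D_n^2})^n$). The logic action is $g\cdot(\prec_1,\ldots,\prec_n)=(\prec_1^g,\ldots,\prec_n^g)$ where $\mathbf{a}\prec_i^g\mathbf{b}$ iff $g^{-1}(\mathbf{a})\prec_ig^{-1}(\mathbf{b})$. A continuous action of a topological group $G$ on a compact Hausdorff space is minimal if every orbit is dense; the universal minimal flow of $G$ is a minimal flow $X$ such that for every minimal flow $Y$ of $G$ there is a continuous surjective $G$-equivariant map $X\to Y$ (it is unique up to $G$-equivariant homeomorphism). *)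

theory Defs
  imports "HOL-Analysis.Analysis"
begin

definition rat_top :: "rat topology" where
  "rat_top = topology_generated_by {{x. a < x \<and> x < b} | a b. True}"

text \<open>Q^n with the product topology; the coordinates are indexed by a finite type 'n
  (with CARD('n) = n).\<close>
definition ratn_top :: "('n \<Rightarrow> rat) topology" where
  "ratn_top = product_topology (\<lambda>_. rat_top) UNIV"

definition prod_less :: "('n \<Rightarrow> rat) \<Rightarrow> ('n \<Rightarrow> rat) \<Rightarrow> bool" where
  "prod_less a b \<longleftrightarrow> (\<forall>i. a i \<le> b i) \<and> a \<noteq> b"

definition admissible_D :: "('n \<Rightarrow> rat) set \<Rightarrow> bool" where
  "admissible_D D \<longleftrightarrow>
     ratn_top closure_of D = topspace ratn_top \<and>
     (\<forall>a\<in>D. \<forall>b\<in>D. a \<noteq> b \<longrightarrow> (\<forall>i. a i \<noteq> b i))"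

definition Aut :: "('n \<Rightarrow> rat) set \<Rightarrow> (('n \<Rightarrow> rat) \<Rightarrow> ('n \<Rightarrow> rat)) set" where
  "Aut D = {g \<in> extensional D. bij_betw g D D \<and>
              (\<forall>a\<in>D. \<forall>b\<in>D. prod_less a b \<longleftrightarrow> prod_less (g a) (g b))}"

definition Aut_mult :: "('n \<Rightarrow> rat) set \<Rightarrow> (('n \<Rightarrow> rat) \<Rightarrow> ('n \<Rightarrow> rat))
     \<Rightarrow> (('n \<Rightarrow> rat) \<Rightarrow> ('n \<Rightarrow> rat)) \<Rightarrow> (('n \<Rightarrow> rat) \<Rightarrow> ('n \<Rightarrow> rat))" where
  "Aut_mult D g h = restrict (g \<circ> h) D"

definition Aut_one :: "('n \<Rightarrow> rat) set \<Rightarrow> (('n \<Rightarrow> rat) \<Rightarrow> ('n \<Rightarrow> rat))" where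
  "Aut_one D = restrict id D"

definition Aut_top :: "('n \<Rightarrow> rat) set \<Rightarrow> (('n \<Rightarrow> rat) \<Rightarrow> ('n \<Rightarrow> rat)) topology" where
  "Aut_top D = subtopology (product_topology (\<lambda>_. discrete_topology D) D) (Aut D)"

definition is_flow ::
  "'g set \<Rightarrow> ('g \<Rightarrow> 'g \<Rightarrow> 'g) \<Rightarrow> 'g \<Rightarrow> 'g topology \<Rightarrow> 'x topology \<Rightarrow> ('g \<Rightarrow> 'x \<Rightarrow> 'x) \<Rightarrow> bool"
  where
  "is_flow G gmul gone Gtop X act \<longleftrightarrow>
     compact_space X \<and> Hausdorff_space X \<and>
     (\<forall>g\<in>G. \<forall>x\<in>topspace X. act g x \<in> topspace X) \<and>
     (\<forall>x\<in>topspace X. act gone x = x) \<and>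
     (\<forall>g\<in>G. \<forall>h\<in>G. \<forall>x\<in>topspace X. act (gmul g h) x = act g (act h x)) \<and>
     continuous_map (prod_topology Gtop X) X (\<lambda>(g, x). act g x)"

definition is_minimal_flow ::
  "'g set \<Rightarrow> ('g \<Rightarrow> 'g \<Rightarrow> 'g) \<Rightarrow> 'g \<Rightarrow> 'g topology \<Rightarrow> 'x topology \<Rightarrow> ('g \<Rightarrow> 'x \<Rightarrow> 'x) \<Rightarrow> bool"
  where
  "is_minimal_flow G gmul gone Gtop X act \<longleftrightarrow>
     is_flow G gmul gone Gtop X act \<and> topspace X \<noteq> {} \<and>
     (\<forall>x\<in>topspace X. X closure_of ((\<lambda>g. act g x) ` G) = topspace X)"

definition is_universal_minimal_flow ::
  "'y itself \<Rightarrow> 'g set \<Rightarrow> ('g \<Rightarrow> 'g \<Rightarrow> 'g) \<Rightarrow> 'g \<Rightarrow> 'g topology \<Rightarrow> 'x topology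
     \<Rightarrow> ('g \<Rightarrow> 'x \<Rightarrow> 'x) \<Rightarrow> bool"
  where
  "is_universal_minimal_flow (TYPE('y)) G gmul gone Gtop X act \<longleftrightarrow>
     is_minimal_flow G gmul gone Gtop X act \<and>
     (\<forall>(Y :: 'y topology) actY. is_minimal_flow G gmul gone Gtop Y actY \<longrightarrow>
        (\<exists>\<pi>. continuous_map X Y \<pi> \<and> \<pi> ` topspace X = topspace Y \<and>
             (\<forall>g\<in>G. \<forall>x\<in>topspace X. \<pi> (act g x) = actY g (\<pi> x))))"

text \<open>An n-tuple of binary relations on D is encoded as its characteristic function on
  'n \<times> D \<times> D (undefined elsewhere); r (i, a, b) means a \<prec>_i b.\<close>
definition strict_linear_order_on :: "'a set \<Rightarrow> ('a \<Rightarrow> 'a \<Rightarrow> bool) \<Rightarrow> bool" where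
  "strict_linear_order_on A R \<longleftrightarrow>
     (\<forall>a\<in>A. \<not> R a a) \<and>
     (\<forall>a\<in>A. \<forall>b\<in>A. \<forall>c\<in>A. R a b \<longrightarrow> R b c \<longrightarrow> R a c) \<and>
     (\<forall>a\<in>A. \<forall>b\<in>A. a \<noteq> b \<longrightarrow> R a b \<or> R b a)"

definition Rn :: "('n \<Rightarrow> rat) set \<Rightarrow> ('n \<times> ('n \<Rightarrow> rat) \<times> ('n \<Rightarrow> rat) \<Rightarrow> bool) set" where
  "Rn D = {r \<in> extensional (UNIV \<times> D \<times> D).
             (\<forall>i. strict_linear_order_on D (\<lambda>a b. r (i, a, b))) \<and>
             (\<forall>a\<in>D. \<forall>b\<in>D. prod_less a b \<longleftrightarrow> (\<forall>i. r (i, a, b)))}"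

definition Rn_top :: "('n \<Rightarrow> rat) set \<Rightarrow> ('n \<times> ('n \<Rightarrow> rat) \<times> ('n \<Rightarrow> rat) \<Rightarrow> bool) topology" where
  "Rn_top D = subtopology (product_topology (\<lambda>_. discrete_topology UNIV) (UNIV \<times> D \<times> D)) (Rn D)"

definition logic_action ::
  "('n \<Rightarrow> rat) set \<Rightarrow> (('n \<Rightarrow> rat) \<Rightarrow> ('n \<Rightarrow> rat))
     \<Rightarrow> ('n \<times> ('n \<Rightarrow> rat) \<times> ('n \<Rightarrow> rat) \<Rightarrow> bool)
     \<Rightarrow> ('n \<times> ('n \<Rightarrow> rat) \<times> ('n \<Rightarrow> rat) \<Rightarrow> bool)" where
  "logic_action D g r = restrict (\<lambda>(i, a, b). r (i, inv_into D g a, inv_into D g b)) (UNIV \<times> D \<times> D)"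

end

theory Submission
  imports Defs "HOL-Library.Ramsey"
begin

text \<open>
  The flow is finite: the only realizers of the order by \<open>n\<close> linear orders are the \<open>n!\<close>
  arrangements of the coordinate orders. Indeed, for each coordinate \<open>i\<close> consider the pairs
  \<open>(a, b)\<close> with \<open>a\<close> above \<open>b\<close> in coordinate \<open>i\<close> only. Any such pair and a
  sufficiently wide one can be completed to standard examples \<open>S\<^sub>n\<close> by the same pairs for the other coordinates; since a linear extension reverses
  at most one critical pair of a standard example, all pairs for \<open>i\<close> are reversed by the same
  one of the \<open>n\<close> orders, and this order must be the order by coordinate \<open>i\<close>.
  A back-and-forth argument shows that the automorphism group permutes these arrangements
  transitively, which gives minimality.

  Let \<open>H\<close> be the stabilizer of the tuple \<open>r\<close> of coordinate orders. If \<open>H\<close> fixes a point \<open>y\<close> of a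
  minimal flow, then \<open>g r \<mapsto> g y\<close> is a well-defined equivariant map with finite, hence closed, image. So it
  remains to find a fixed point of \<open>H\<close> in every flow. Otherwise, by compactness, finitely many open
  sets \<open>V\<close> with \<open>h V \<inter> V = {}\<close> for some \<open>h \<in> H\<close> cover the flow in such a way that an orbit colours the copies
  of a finite set \<open>A \<subseteq> D\<close> by these sets. A Ramsey argument moves \<open>A\<close> and its images under the finitely
  many \<open>h\<inverse>\<close> to copies of the same colour, a contradiction. The product Ramsey
  theorem needed here follows from the ordinary one for \<open>(n \<cdot> card A)\<close>-element sets of naturals, by cutting
  a homogeneous set into \<open>n\<close> consecutive blocks, one for each coordinate.
\<close>

section \<open>Homogeneity\<close>

definition coord_emb ::
  "('n \<Rightarrow> 'n) \<Rightarrow> ('n \<Rightarrow> rat) set \<Rightarrow> (('n \<Rightarrow> rat) \<Rightarrow> ('n \<Rightarrow> rat)) \<Rightarrow> bool" where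
  "coord_emb \<sigma> A f \<longleftrightarrow> (\<forall>x\<in>A. \<forall>y\<in>A. \<forall>i. x i < y i \<longleftrightarrow> f x (\<sigma> i) < f y (\<sigma> i))"

text \<open>For \<open>\<sigma> = id\<close> this is the stabilizer \<open>H\<close> of the tuple of
  coordinate orders; the other permutations give the automorphisms that carry this tuple to its
  rearrangements.\<close>

definition perm_aut ::
  "('n \<Rightarrow> rat) set \<Rightarrow> ('n \<Rightarrow> 'n) \<Rightarrow> (('n \<Rightarrow> rat) \<Rightarrow> ('n \<Rightarrow> rat)) set" where
  "perm_aut D \<sigma> = {g \<in> extensional D. bij_betw g D D \<and> coord_emb \<sigma> D g}"

definition perm_orders ::
  "('n \<Rightarrow> rat) set \<Rightarrow> ('n \<Rightarrow> 'n) \<Rightarrow> 'n \<times> ('n \<Rightarrow> rat) \<times> ('n \<Rightarrow> rat) \<Rightarrow> bool" where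
  "perm_orders D \<sigma> = restrict (\<lambda>(i, a, b). a (\<sigma> i) < b (\<sigma> i)) (UNIV \<times> D \<times> D)"

section \<open>Extension of finite partial isomorphisms and back-and-forth\<close>

lemma finite_gap:
  fixes L U :: "'a::{linorder, no_top, no_bot} set"
  assumes "finite L" "finite U" and less: "\<And>l u. l \<in> L \<Longrightarrow> u \<in> U \<Longrightarrow> l < u"
  shows "\<exists>lo hi. lo < hi \<and> (\<forall>l\<in>L. l \<le> lo) \<and> (\<forall>u\<in>U. hi \<le> u)"
proof (cases "L = {}")
  case True
  obtain hi where hi: "\<forall>u\<in>U. hi \<le> u"
    using assms(2) Min_le by (cases "U = {}") blast+
  obtain lo where "lo < hi" using lt_ex by blast
  with True hi show ?thesis by blast
next
  case False
  show ?thesis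
  proof (cases "U = {}")
    case True
    obtain hi where "Max L < hi" using gt_ex by blast
    with True show ?thesis using assms(1) by (intro exI[of _ "Max L"] exI[of _ hi]) auto
  next
    case ne: False
    then show ?thesis using assms False
      by (intro exI[of _ "Max L"] exI[of _ "Min U"]) auto
  qed
qed

text \<open>Density (\<open>box\<close>) and general position (\<open>coord_inj\<close>), free of
  topology; \<open>generic_dense_of_admissible\<close> derives both from
  \<open>admissible_D\<close>.\<close>

locale generic_dense =
  fixes D :: "('n::finite \<Rightarrow> rat) set"
  assumes box: "(\<And>i. lo i < hi i) \<Longrightarrow> \<exists>x\<in>D. \<forall>i. lo i < x i \<and> x i < hi i"
    and coord_inj: "a \<in> D \<Longrightarrow> b \<in> D \<Longrightarrow> a i = b i \<Longrightarrow> a = b"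
begin

text \<open>Permuting the coordinates on both sides makes the notion symmetric under converse,
  so that one extension lemma serves both directions of the back-and-forth argument.\<close>

definition partial_iso ::
  "('n \<Rightarrow> 'n) \<Rightarrow> ('n \<Rightarrow> 'n) \<Rightarrow> (('n \<Rightarrow> rat) \<times> ('n \<Rightarrow> rat)) set \<Rightarrow> bool" where
  "partial_iso s t P \<longleftrightarrow> P \<subseteq> D \<times> D \<and>
     (\<forall>x y x' y'. (x, y) \<in> P \<longrightarrow> (x', y') \<in> P \<longrightarrow>
       (\<forall>i. x (s i) < x' (s i) \<longleftrightarrow> y (t i) < y' (t i)))"

lemma partial_iso_converse: "partial_iso s t P \<Longrightarrow> partial_iso t s (P\<inverse>)"
  unfolding partial_iso_def converse_iff by blast

lemma partial_isoD:
  "partial_iso s t P \<Longrightarrow> (x, y) \<in> P \<Longrightarrow> (x', y') \<in> P \<Longrightarrow> x (s i) < x' (s i) \<longleftrightarrow> y (t i) < y' (t i)"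
  unfolding partial_iso_def by blast

text \<open>In each coordinate the values that must lie below the image of \<open>x\<close> and
  those that must lie above it are finite sets with a gap between them. The gaps of all coordinates
  form a box, so a single point of \<open>D\<close> fits into all of them at once.\<close>

lemma partial_iso_extend:
  assumes P: "partial_iso s t P" and fin: "finite P" and t: "bij t" and x: "x \<in> D"
  shows "\<exists>P'. finite P' \<and> P \<subseteq> P' \<and> partial_iso s t P' \<and> x \<in> Domain P'"
proof (cases "x \<in> Domain P")
  case True
  with P fin show ?thesis by blast
next
  case False
  \<comment> \<open>The target coordinate \<open>j = t i\<close> is matched with the source
    coordinate \<open>s i\<close>, where \<open>i = inv t j\<close>.\<close>
  define L where "L j = (\<lambda>(x', y). y j) ` {(x', y)\<in>P. x' (s (inv t j)) < x (s (inv t j))}" for j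
  define U where "U j = (\<lambda>(x', y). y j) ` {(x', y)\<in>P. x (s (inv t j)) < x' (s (inv t j))}" for j
  have tinv: "t (inv t j) = j" "inv t (t j) = j" for j
    using t by (simp_all add: bij_is_surj surj_f_inv_f bij_is_inj)
  have "\<exists>lo hi. lo < hi \<and> (\<forall>l\<in>L j. l \<le> lo) \<and> (\<forall>u\<in>U j. hi \<le> u)" for j
  proof (rule finite_gap)
    show "finite (L j)" "finite (U j)"
      unfolding L_def U_def using fin by (auto intro!: finite_imageI intro: rev_finite_subset)
  next
    fix l u assume "l \<in> L j" "u \<in> U j"
    then obtain x' y' x'' y'' where "(x', y') \<in> P" "(x'', y'') \<in> P" "l = y' j" "u = y'' j"
      "x' (s (inv t j)) < x (s (inv t j))" "x (s (inv t j)) < x'' (s (inv t j))"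
      unfolding L_def U_def by auto
    then show "l < u" using partial_isoD[OF P, of x' y' x'' y'' "inv t j"] tinv by auto
  qed
  then obtain lo hi where lohi: "\<And>j. lo j < hi j" "\<And>j l. l \<in> L j \<Longrightarrow> l \<le> lo j"
    "\<And>j u. u \<in> U j \<Longrightarrow> hi j \<le> u" by metis
  from box[of lo hi, OF lohi(1)] obtain y where y: "y \<in> D" "\<And>j. lo j < y j" "\<And>j. y j < hi j"
    by blast
  have cmp: "(x' (s i) < x (s i) \<and> y' (t i) < y (t i)) \<or> (x (s i) < x' (s i) \<and> y (t i) < y' (t i))"
    if "(x', y') \<in> P" for x' y' i
  proof -
    have "x' \<noteq> x" using False that by blast
    moreover have "x' \<in> D" using P that unfolding partial_iso_def by blast
    ultimately have "x' (s i) \<noteq> x (s i)" using coord_inj x by blast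
    then consider "x' (s i) < x (s i)" | "x (s i) < x' (s i)" by (rule linorder_neqE)
    then show ?thesis
    proof cases
      case 1
      then have "y' (t i) \<in> L (t i)" unfolding L_def using that tinv
        by (intro image_eqI[of _ _ "(x', y')"]) auto
      then have "y' (t i) < y (t i)" by (rule le_less_trans[OF lohi(2) y(2)])
      with 1 show ?thesis by blast
    next
      case 2
      then have "y' (t i) \<in> U (t i)" unfolding U_def using that tinv
        by (intro image_eqI[of _ _ "(x', y')"]) auto
      then have "y (t i) < y' (t i)" by (rule less_le_trans[OF y(3) lohi(3)])
      with 2 show ?thesis by blast
    qed
  qed
  have "a (s i) < a' (s i) \<longleftrightarrow> b (t i) < b' (t i)"
    if "(a, b) \<in> insert (x, y) P" "(a', b') \<in> insert (x, y) P" for a b a' b' i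
  proof -
    from that consider "(a, b) \<in> P" "(a', b') \<in> P" | "(a, b) \<in> P" "a' = x" "b' = y"
      | "(a', b') \<in> P" "a = x" "b = y" | "a = x" "b = y" "a' = x" "b' = y"
      by blast
    then show ?thesis
    proof cases
      case 1
      with P show ?thesis by (rule partial_isoD)
    next
      case 2
      with cmp[OF 2(1), of i] show ?thesis by auto
    next
      case 3
      with cmp[OF 3(1), of i] show ?thesis by auto
    qed auto
  qed
  moreover have "insert (x, y) P \<subseteq> D \<times> D"
    using P x y(1) unfolding partial_iso_def by blast
  ultimately have "partial_iso s t (insert (x, y) P)"
    unfolding partial_iso_def by (intro conjI allI impI)
  with fin have "finite (insert (x, y) P) \<and> P \<subseteq> insert (x, y) P \<and>
    partial_iso s t (insert (x, y) P) \<and> x \<in> Domain (insert (x, y) P)" by blast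
  then show ?thesis by (rule exI)
qed

text \<open>Forth is an extension of \<open>P\<close>, back an extension of the converse, in which
  the two coordinate maps change places.\<close>

lemma partial_iso_extend_both:
  assumes "partial_iso id \<sigma> P" "finite P" "bij \<sigma>" "x \<in> D"
  shows "\<exists>P'. finite P' \<and> P \<subseteq> P' \<and> partial_iso id \<sigma> P' \<and> x \<in> Domain P' \<and> x \<in> Range P'"
proof -
  obtain Q where Q: "finite Q" "P \<subseteq> Q" "partial_iso id \<sigma> Q" "x \<in> Domain Q"
    using partial_iso_extend[OF assms(1,2,3,4)] by blast
  obtain R where R: "finite R" "Q\<inverse> \<subseteq> R" "partial_iso \<sigma> id R" "x \<in> Domain R"
    using partial_iso_extend[OF partial_iso_converse[OF Q(3)] _ bij_id assms(4)] Q(1) by auto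
  have "finite (R\<inverse>)" "P \<subseteq> R\<inverse>" "partial_iso id \<sigma> (R\<inverse>)" "x \<in> Domain (R\<inverse>)" "x \<in> Range (R\<inverse>)"
    using R Q partial_iso_converse[OF R(3)] by auto
  then show ?thesis by blast
qed

lemma D_nonempty: "D \<noteq> {}"
  using box[of "\<lambda>_. 0" "\<lambda>_. 1"] by force

text \<open>\<open>D\<close> is countable: adding its points one after another to domain and range
  of a finite partial isomorphism yields a chain whose union is the graph of
  \<open>g\<close>.\<close>

lemma back_and_forth:
  assumes \<sigma>: "bij \<sigma>" and A: "finite A" "A \<subseteq> D" "f ` A \<subseteq> D" "coord_emb \<sigma> A f"
  shows "\<exists>g\<in>perm_aut D \<sigma>. \<forall>x\<in>A. g x = f x"
proof -
  let ?e = "from_nat_into D"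
  have range_e: "range ?e = D"
    using D_nonempty by (simp add: range_from_nat_into)
  define P0 where "P0 = (\<lambda>x. (x, f x)) ` A"
  define good where "good P \<longleftrightarrow> finite P \<and> P0 \<subseteq> P \<and> partial_iso id \<sigma> P" for P
  have "good P0"
    using A unfolding good_def P0_def partial_iso_def coord_emb_def id_apply by blast
  then have "\<exists>P. good P" by blast
  moreover have "\<exists>P'. good P' \<and> P \<subseteq> P' \<and> ?e n \<in> Domain P' \<and> ?e n \<in> Range P'" if "good P" for P n
  proof -
    have "?e n \<in> D" using range_e by blast
    with partial_iso_extend_both[OF _ _ \<sigma>, of P "?e n"] that
    obtain P' where "finite P'" "P \<subseteq> P'" "partial_iso id \<sigma> P'" "?e n \<in> Domain P'" "?e n \<in> Range P'"
      unfolding good_def by blast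
    then show ?thesis using that unfolding good_def by blast
  qed
  ultimately have "\<exists>Q. \<forall>n. good (Q n) \<and> Q n \<subseteq> Q (Suc n) \<and> ?e n \<in> Domain (Q (Suc n)) \<and> ?e n \<in> Range (Q (Suc n))"
    by (rule dependent_nat_choice)
  then obtain Q where Q: "\<And>n. good (Q n)" "\<And>n. Q n \<subseteq> Q (Suc n)"
    "\<And>n. ?e n \<in> Domain (Q (Suc n))" "\<And>n. ?e n \<in> Range (Q (Suc n))" by blast
  define R where "R = (\<Union>n. Q n)"
  have mono: "m \<le> n \<Longrightarrow> Q m \<subseteq> Q n" for m n
    using lift_Suc_mono_le[of Q] Q(2) by blast
  have RD: "R \<subseteq> D \<times> D" using Q(1) unfolding R_def good_def partial_iso_def by blast
  have Rcmp: "x i < x' i \<longleftrightarrow> y (\<sigma> i) < y' (\<sigma> i)" if "(x, y) \<in> R" "(x', y') \<in> R" for x y x' y' i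
  proof -
    from that obtain m n where "(x, y) \<in> Q m" "(x', y') \<in> Q n" unfolding R_def by blast
    then have "(x, y) \<in> Q (max m n)" "(x', y') \<in> Q (max m n)"
      using mono[of m "max m n"] mono[of n "max m n"] by auto
    moreover have "partial_iso id \<sigma> (Q (max m n))" using Q(1) good_def by blast
    ultimately show ?thesis using partial_isoD[of id \<sigma> _ x y x' y' i] by simp
  qed
  have dom: "\<exists>y. (x, y) \<in> R" if "x \<in> D" for x
  proof -
    from that obtain n where "x = ?e n" using range_e by blast
    then show ?thesis using Q(3)[of n] unfolding R_def by blast
  qed
  have ran: "\<exists>x. (x, y) \<in> R" if "y \<in> D" for y
  proof -
    from that obtain n where "y = ?e n" using range_e by blast
    then show ?thesis using Q(4)[of n] unfolding R_def by blast
  qed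
  have single: "y = y'" if "(x, y) \<in> R" "(x, y') \<in> R" for x y y'
  proof -
    \<comment> \<open>A point is determined by any one of its coordinates; \<open>undefined\<close>
      merely names one.\<close>
    have "y (\<sigma> undefined) = y' (\<sigma> undefined)"
      using Rcmp[OF that, of undefined] Rcmp[OF that(2,1), of undefined] by auto
    moreover have "y \<in> D" "y' \<in> D" using that RD by auto
    ultimately show ?thesis using coord_inj by blast
  qed
  have inj: "x = x'" if "(x, y) \<in> R" "(x', y) \<in> R" for x x' y
  proof -
    have "x undefined = x' undefined"
      using Rcmp[OF that, of undefined] Rcmp[OF that(2,1), of undefined] by auto
    moreover have "x \<in> D" "x' \<in> D" using that RD by auto
    ultimately show ?thesis using coord_inj by blast
  qed
  define g where "g = restrict (\<lambda>x. THE y. (x, y) \<in> R) D"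
  have g_eq: "g x = y" if "(x, y) \<in> R" for x y
  proof -
    have "x \<in> D" using that RD by blast
    then have "g x = (THE y. (x, y) \<in> R)" unfolding g_def by simp
    also have "\<dots> = y"
    proof (rule the_equality)
      show "(x, y) \<in> R" by (fact that)
      show "y' = y" if "(x, y') \<in> R" for y' using that \<open>(x, y) \<in> R\<close> by (rule single)
    qed
    finally show ?thesis .
  qed
  have gR: "(x, g x) \<in> R" if "x \<in> D" for x
    using dom[OF that] g_eq by blast
  have "bij_betw g D D"
    unfolding bij_betw_def
  proof
    show "inj_on g D"
    proof (rule inj_onI)
      fix x x' assume *: "x \<in> D" "x' \<in> D" "g x = g x'"
      then show "x = x'" using inj[of x "g x" x'] gR[of x] gR[of x'] by simp
    qed
    have "g x \<in> D" if "x \<in> D" for x using gR[OF that] RD by blast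
    moreover have "y \<in> g ` D" if y: "y \<in> D" for y
    proof -
      obtain x where x: "(x, y) \<in> R" using ran[OF y] by blast
      moreover have "x \<in> D" using x RD by blast
      ultimately show ?thesis using g_eq[OF x] by blast
    qed
    ultimately show "g ` D = D" by blast
  qed
  moreover have "coord_emb \<sigma> D g" unfolding coord_emb_def by (intro ballI allI Rcmp gR)
  moreover have "g x = f x" if "x \<in> A" for x
  proof -
    have "(x, f x) \<in> R" using Q(1)[of 0] that unfolding good_def P0_def R_def by blast
    then show ?thesis by (rule g_eq)
  qed
  moreover have "g \<in> extensional D" unfolding g_def by simp
  ultimately show ?thesis unfolding perm_aut_def by blast
qed

end

text \<open>The midpoint of a box lies in the closure of \<open>D\<close>, and the box is an open
  neighbourhood of it.\<close>

lemma generic_dense_of_admissible: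
  fixes D :: "('n::finite \<Rightarrow> rat) set"
  assumes "admissible_D D"
  shows "generic_dense D"
proof
  fix lo hi :: "'n \<Rightarrow> rat" assume lt: "\<And>i. lo i < hi i"
  let ?B = "\<Pi>\<^sub>E i\<in>UNIV. {x. lo i < x \<and> x < hi i}"
  have top: "topspace rat_top = UNIV"
  proof -
    have "x \<in> \<Union>{{x. a < x \<and> x < b} | a b. True}" for x :: rat
      by (rule UnionI[of "{y. x - 1 < y \<and> y < x + 1}"]) auto
    then show ?thesis unfolding rat_top_def topology_generated_by_topspace by blast
  qed
  have "openin ratn_top ?B"
    unfolding ratn_top_def
    by (rule product_topology_basis) (auto simp: rat_top_def intro: topology_generated_by_Basis)
  moreover have "(\<lambda>i. (lo i + hi i) / 2) \<in> ?B" using lt by (auto simp: field_simps)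
  moreover have "topspace ratn_top = (UNIV :: ('n \<Rightarrow> rat) set)"
    unfolding ratn_top_def using top by (simp add: PiE_UNIV_domain)
  then have "(\<lambda>i. (lo i + hi i) / 2) \<in> ratn_top closure_of D"
    using assms unfolding admissible_D_def by simp
  ultimately obtain x where "x \<in> D" "x \<in> ?B"
    unfolding in_closure_of by blast
  then show "\<exists>x\<in>D. \<forall>i. lo i < x i \<and> x i < hi i" by auto
next
  fix a b i assume "a \<in> D" "b \<in> D" "a i = b i"
  then show "a = b" using assms unfolding admissible_D_def by blast
qed

section \<open>Realizers of the product order\<close>

context generic_dense
begin

text \<open>These are the critical pairs of standard examples: some order of every realizer must put
  \<open>b\<close> below \<open>a\<close>.\<close>

definition critical :: "'n \<Rightarrow> ('n \<Rightarrow> rat) \<Rightarrow> ('n \<Rightarrow> rat) \<Rightarrow> bool" where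
  "critical i a b \<longleftrightarrow> a \<in> D \<and> b \<in> D \<and> b i < a i \<and> (\<forall>j. j \<noteq> i \<longrightarrow> a j < b j)"

lemma prod_less_iff:
  assumes "a \<in> D" "b \<in> D"
  shows "prod_less a b \<longleftrightarrow> (\<forall>i. a i < b i)"
proof
  assume *: "prod_less a b"
  then have "a i \<noteq> b i" for i using coord_inj assms unfolding prod_less_def by blast
  with * show "\<forall>i. a i < b i" unfolding prod_less_def by (simp add: order_less_le)
next
  assume "\<forall>i. a i < b i"
  then show "prod_less a b" unfolding prod_less_def by (auto simp: order_less_le)
qed

lemma box_obtain:
  assumes "\<And>i. lo i < hi i"
  obtains x where "x \<in> D" "\<And>i. lo i < x i" "\<And>i. x i < hi i"
  using box[of lo hi] assms by blast

lemma perm_orders_apply: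
  "a \<in> D \<Longrightarrow> b \<in> D \<Longrightarrow> perm_orders D \<sigma> (i, a, b) \<longleftrightarrow> a (\<sigma> i) < b (\<sigma> i)"
  unfolding perm_orders_def by simp

lemma perm_orders_in_Rn:
  assumes "bij \<sigma>"
  shows "perm_orders D \<sigma> \<in> Rn D"
proof -
  have "strict_linear_order_on D (\<lambda>a b. perm_orders D \<sigma> (i, a, b))" for i
    unfolding strict_linear_order_on_def
  proof (intro conjI ballI impI)
    fix a b assume "a \<in> D" "b \<in> D" "a \<noteq> b"
    then show "perm_orders D \<sigma> (i, a, b) \<or> perm_orders D \<sigma> (i, b, a)"
      using coord_inj[of a b "\<sigma> i"] by (auto simp: perm_orders_apply)
  qed (auto simp: perm_orders_apply)
  moreover have "prod_less a b \<longleftrightarrow> (\<forall>i. perm_orders D \<sigma> (i, a, b))" if "a \<in> D" "b \<in> D" for a b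
  proof -
    have "(\<forall>i. a i < b i) \<longleftrightarrow> (\<forall>i. a (\<sigma> i) < b (\<sigma> i))"
      using bij_is_surj[OF assms] by (metis surjD)
    with that show ?thesis by (simp add: prod_less_iff perm_orders_apply)
  qed
  ultimately show ?thesis unfolding Rn_def by (simp add: perm_orders_def)
qed

text \<open>Where the maps differ, take \<open>a\<close> in the unit cube and \<open>b\<close> above
  it in coordinate \<open>\<sigma> i\<close> but below it in all others. The maps are arbitrary, as
  constant ones occur in \<open>Rn_is_perm_orders\<close>.\<close>

lemma perm_orders_inj:
  assumes "perm_orders D \<sigma> = perm_orders D \<tau>"
  shows "\<sigma> = \<tau>"
proof
  fix i
  show "\<sigma> i = \<tau> i"
  proof (rule ccontr)
    assume ne: "\<sigma> i \<noteq> \<tau> i"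
    obtain a where a: "a \<in> D" "\<And>j. 0 < a j \<and> a j < 1"
      using box[of "\<lambda>_. 0" "\<lambda>_. 1"] by auto
    have lt: "(if j = \<sigma> i then 1 else -1) < (if j = \<sigma> i then 2 else (0::rat))" for j by simp
    obtain b where b: "b \<in> D" "\<And>j. (if j = \<sigma> i then 1 else -1) < b j"
      "\<And>j. b j < (if j = \<sigma> i then 2 else 0)"
      using box_obtain[of "\<lambda>j. if j = \<sigma> i then 1 else -1" "\<lambda>j. if j = \<sigma> i then 2 else 0", OF lt] by blast
    have "a (\<sigma> i) < b (\<sigma> i)" using a(2)[of "\<sigma> i"] b(2)[of "\<sigma> i"] by simp
    moreover have "b (\<tau> i) < a (\<tau> i)" using a(2)[of "\<tau> i"] b(3)[of "\<tau> i"] ne by simp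
    ultimately show False
      using fun_cong[OF assms, of "(i, a, b)"] a b by (simp add: perm_orders_apply)
  qed
qed

text \<open>Critical pairs made to measure: coordinate \<open>i\<close> is reversed around the
  midpoint of the window from \<open>l\<close> to \<open>h\<close>, and in every other coordinate
  the pair encloses the box from \<open>lo\<close> to \<open>hi\<close>.\<close>

lemma critical_box:
  assumes "l < h" and "\<And>j. lo j < hi j" and "lo i \<le> l" "h \<le> hi i"
  obtains a b where "critical i a b" "l < b i" "a i < h"
    "\<And>j. j \<noteq> i \<Longrightarrow> a j < lo j" "\<And>j. j \<noteq> i \<Longrightarrow> hi j < b j"
proof -
  let ?m = "(l + h) / 2"
  have m: "l < ?m" "?m < h" using assms(1) by (simp_all add: field_simps)
  have lt_a: "(if j = i then ?m else lo j - 1) < (if j = i then h else lo j)" for j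
    using m by simp
  have lt_b: "(if j = i then l else hi j) < (if j = i then ?m else hi j + 1)" for j
    using m by simp
  obtain a where a: "a \<in> D" "\<And>j. (if j = i then ?m else lo j - 1) < a j"
    "\<And>j. a j < (if j = i then h else lo j)"
    by (rule box_obtain[of "\<lambda>j. if j = i then ?m else lo j - 1" "\<lambda>j. if j = i then h else lo j", OF lt_a]) blast
  obtain b where b: "b \<in> D" "\<And>j. (if j = i then l else hi j) < b j"
    "\<And>j. b j < (if j = i then ?m else hi j + 1)"
    by (rule box_obtain[of "\<lambda>j. if j = i then l else hi j" "\<lambda>j. if j = i then ?m else hi j + 1", OF lt_b]) blast
  have ai: "?m < a i" "a i < h" and bi: "l < b i" "b i < ?m"
    using a(2,3)[of i] b(2,3)[of i] by simp_all
  have aj: "a j < lo j" "hi j < b j" if "j \<noteq> i" for j using that a(3)[of j] b(2)[of j] by simp_all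
  have "a j < b j" if "j \<noteq> i" for j
    using aj[OF that] assms(2)[of j] by simp
  then have "critical i a b" unfolding critical_def using a b ai bi by auto
  with ai bi aj show ?thesis using that by blast
qed

section \<open>Critical pairs in an arbitrary realizer\<close>

context
  fixes r assumes r: "r \<in> Rn D"
begin

lemma Rn_irrefl: "a \<in> D \<Longrightarrow> \<not> r (k, a, a)"
  and Rn_trans: "a \<in> D \<Longrightarrow> b \<in> D \<Longrightarrow> c \<in> D \<Longrightarrow> r (k, a, b) \<Longrightarrow> r (k, b, c) \<Longrightarrow> r (k, a, c)"
  and Rn_total: "a \<in> D \<Longrightarrow> b \<in> D \<Longrightarrow> a \<noteq> b \<Longrightarrow> r (k, a, b) \<or> r (k, b, a)"
proof -
  have "strict_linear_order_on D (\<lambda>a b. r (k, a, b))" using r unfolding Rn_def by simp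
  then show "a \<in> D \<Longrightarrow> \<not> r (k, a, a)"
    "a \<in> D \<Longrightarrow> b \<in> D \<Longrightarrow> c \<in> D \<Longrightarrow> r (k, a, b) \<Longrightarrow> r (k, b, c) \<Longrightarrow> r (k, a, c)"
    "a \<in> D \<Longrightarrow> b \<in> D \<Longrightarrow> a \<noteq> b \<Longrightarrow> r (k, a, b) \<or> r (k, b, a)"
    unfolding strict_linear_order_on_def by metis+
qed

lemma Rn_prod:
  assumes "a \<in> D" "b \<in> D"
  shows "(\<forall>i. a i < b i) \<longleftrightarrow> (\<forall>k. r (k, a, b))"
proof -
  have "prod_less a b \<longleftrightarrow> (\<forall>k. r (k, a, b))" using r assms unfolding Rn_def by simp
  then show ?thesis using prod_less_iff[OF assms] by simp
qed

text \<open>Otherwise totality would put \<open>a\<close> below \<open>b\<close> in all orders,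
  hence in the product order, against coordinate \<open>i\<close>.\<close>

lemma critical_reversed:
  assumes "critical i a b"
  shows "\<exists>k. r (k, b, a)"
proof -
  have "a \<in> D" "b \<in> D" "\<not> (\<forall>i. a i < b i)" "a \<noteq> b"
    using assms unfolding critical_def by (auto dest: less_asym)
  then show ?thesis using Rn_prod Rn_total by blast
qed

text \<open>If order \<open>k\<close> reversed both pairs, then \<open>b\<close>, \<open>a\<close>,
  \<open>b'\<close>, \<open>a'\<close>, \<open>b\<close> would be a cycle in it.\<close>

lemma reversed_distinct:
  assumes "critical i a b" "critical j a' b'" "\<forall>m. a m < b' m" "\<forall>m. a' m < b m"
    and "r (k, b, a)"
  shows "\<not> r (k, b', a')"
proof
  assume *: "r (k, b', a')"
  have D: "a \<in> D" "b \<in> D" "a' \<in> D" "b' \<in> D" using assms unfolding critical_def by auto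
  have "r (k, a, b')" "r (k, a', b)" using Rn_prod D assms by blast+
  then have "r (k, b, b)" using assms(5) * D Rn_trans by blast
  with Rn_irrefl D show False by blast
qed

text \<open>Both pairs extend to standard examples by the same critical pairs \<open>(p j, q j)\<close>, \<open>j \<noteq> i\<close>. These use up
  all but one of the orders, and the remaining one has to reverse both.\<close>

lemma reversed_unique_wide:
  assumes c: "critical i a b" "critical i a' b'"
    and wide: "\<And>j. j \<noteq> i \<Longrightarrow> a j < b' j \<and> a' j < b j"
    and k: "r (k, b, a)" "r (k', b', a')"
  shows "k = k'"
proof -
  \<comment> \<open>The box from \<open>lo\<close> to \<open>hi\<close> strictly contains the four
    given points, so that the auxiliary pairs can be placed around it.\<close>
  define lo where "lo m = min (min (a m) (b m)) (min (a' m) (b' m)) - 1" for m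
  define hi where "hi m = max (max (a m) (b m)) (max (a' m) (b' m)) + 1" for m
  have bounds: "lo m < a m" "lo m < b m" "lo m < a' m" "lo m < b' m"
     "a m < hi m" "b m < hi m" "a' m < hi m" "b' m < hi m" for m
    unfolding lo_def hi_def by auto
  have lohi: "lo m < hi m" for m using bounds[of m] by linarith
  \<comment> \<open>Coordinate \<open>j\<close> of \<open>p j\<close> and \<open>q j\<close> is put
    between the values of \<open>a\<close>, \<open>a'\<close> and those of \<open>b\<close>,
    \<open>b'\<close>. This window is nonempty by \<open>wide\<close> and the criticality of both
    pairs.\<close>
  define l where "l j = max (a j) (a' j)" for j
  define h where "h j = min (b j) (b' j)" for j
  have "\<exists>p q. critical j p q \<and> l j < q j \<and> p j < h j \<and> (\<forall>m. m \<noteq> j \<longrightarrow> p m < lo m \<and> hi m < q m)"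
    if "j \<noteq> i" for j
  proof -
    have "l j < h j" using that wide[of j] c unfolding l_def h_def critical_def by auto
    moreover have "lo j \<le> l j" "h j \<le> hi j" using bounds[of j] unfolding l_def h_def by linarith+
    ultimately show ?thesis
      by (rule critical_box[of "l j" "h j" lo hi j, OF _ lohi]) blast
  qed
  then obtain p q where "\<And>j. j \<noteq> i \<Longrightarrow> critical j (p j) (q j) \<and> l j < q j j \<and> p j j < h j \<and>
    (\<forall>m. m \<noteq> j \<longrightarrow> p j m < lo m \<and> hi m < q j m)"
    by metis
  then have pq: "\<And>j. j \<noteq> i \<Longrightarrow> critical j (p j) (q j)"
    "\<And>j. j \<noteq> i \<Longrightarrow> l j < q j j" "\<And>j. j \<noteq> i \<Longrightarrow> p j j < h j"
    "\<And>j m. j \<noteq> i \<Longrightarrow> m \<noteq> j \<Longrightarrow> p j m < lo m" "\<And>j m. j \<noteq> i \<Longrightarrow> m \<noteq> j \<Longrightarrow> hi m < q j m"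
    by blast+
  have below: "p j m < b m" "p j m < b' m" "a m < q j m" "a' m < q j m" if "j \<noteq> i" for j m
    using pq(2,3)[OF that] pq(4,5)[OF that, of m] bounds[of m] unfolding l_def h_def
    by (cases "m = j"; force)+
  \<comment> \<open>In coordinate \<open>j\<close> the point \<open>q j'\<close> lies above the box
    and \<open>p j\<close> below its top; in all others \<open>p j\<close> lies below the box and
    \<open>q j'\<close> above its bottom.\<close>
  have cross: "p j m < q j' m" if "j \<noteq> i" "j' \<noteq> i" "j \<noteq> j'" for j j' m
  proof (cases "m = j")
    case True
    have "p j j < h j" "h j \<le> hi j" "hi j < q j' j"
      using pq(3)[of j] pq(5)[of j' j] bounds[of j] that unfolding h_def by auto
    then show ?thesis unfolding True by linarith
  next
    case False
    then have "p j m < lo m" using pq(4) that by blast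
    also have "lo m < q j' m" using below(3)[OF that(2), of m] bounds[of m] by linarith
    finally show ?thesis .
  qed
  have "\<forall>j. \<exists>k. j \<noteq> i \<longrightarrow> r (k, q j, p j)" using critical_reversed[OF pq(1)] by blast
  from choice[OF this] obtain \<kappa> where \<kappa>: "\<And>j. j \<noteq> i \<Longrightarrow> r (\<kappa> j, q j, p j)"
    by blast
  have "\<kappa> j \<noteq> \<kappa> j'" if "j \<noteq> i" "j' \<noteq> i" "j \<noteq> j'" for j j'
  proof
    assume eq: "\<kappa> j = \<kappa> j'"
    have "\<not> r (\<kappa> j, q j', p j')"
    proof (rule reversed_distinct[OF pq(1)[OF that(1)] pq(1)[OF that(2)] _ _ \<kappa>[OF that(1)]])
      show "\<forall>m. p j m < q j' m" using cross[OF that] by (rule allI)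
      show "\<forall>m. p j' m < q j m" using cross[OF that(2,1) that(3)[symmetric]] by (rule allI)
    qed
    then show False using \<kappa>[OF that(2)] unfolding eq by (rule notE)
  qed
  then have inj: "inj_on \<kappa> (UNIV - {i})" by (intro inj_onI) blast
  have "k \<noteq> \<kappa> j" if "j \<noteq> i" for j
  proof
    assume eq: "k = \<kappa> j"
    have "\<not> r (k, q j, p j)"
      by (rule reversed_distinct[OF c(1) pq(1)[OF that] _ _ k(1)])
        (use below(1,3)[OF that] in blast)+
    then show False using \<kappa>[OF that] unfolding eq by (rule notE)
  qed
  then have "k \<notin> \<kappa> ` (UNIV - {i})" by blast
  moreover have "k' \<noteq> \<kappa> j" if "j \<noteq> i" for j
  proof
    assume eq: "k' = \<kappa> j"
    have "\<not> r (k', q j, p j)"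
      by (rule reversed_distinct[OF c(2) pq(1)[OF that] _ _ k(2)])
        (use below(2,4)[OF that] in blast)+
    then show False using \<kappa>[OF that] unfolding eq by (rule notE)
  qed
  then have "k' \<notin> \<kappa> ` (UNIV - {i})" by blast
  \<comment> \<open>\<open>\<kappa>\<close> is injective on n - 1 coordinates and takes values among
    n orders, so it misses exactly one.\<close>
  moreover have "card (UNIV - \<kappa> ` (UNIV - {i})) = 1"
  proof -
    have "card (UNIV - \<kappa> ` (UNIV - {i})) = CARD('n) - card (UNIV - {i})"
      using card_image[OF inj] by (simp add: card_Diff_subset)
    also have "\<dots> = 1" using finite_UNIV_card_ge_0[where ?'a = 'n] by (simp add: card_Diff_subset)
    finally show ?thesis .
  qed
  then obtain z where z: "UNIV - \<kappa> ` (UNIV - {i}) = {z}" by (rule card_1_singletonE)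
  ultimately have "k \<in> {z}" "k' \<in> {z}" unfolding z[symmetric] by blast+
  then show ?thesis by simp
qed

text \<open>Two critical pairs for \<open>i\<close> need not be wide relative to each other, but a
  third pair that encloses both in all other coordinates is wide relative to each.\<close>

lemma critical_unique_reversed:
  "\<exists>k. \<forall>a b k'. critical i a b \<longrightarrow> r (k', b, a) \<longrightarrow> k' = k"
proof -
  have "k = k'" if c: "critical i a b" "critical i a' b'" "r (k, b, a)" "r (k', b', a')" for a b a' b' k k'
  proof -
    define lo where "lo m = min (min (a m) (b m)) (min (a' m) (b' m)) - 1" for m
    define hi where "hi m = max (max (a m) (b m)) (max (a' m) (b' m)) + 1" for m
    have bounds: "lo m < a m" "lo m < b m" "lo m < a' m" "lo m < b' m"
       "a m < hi m" "b m < hi m" "a' m < hi m" "b' m < hi m" for m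
      unfolding lo_def hi_def by auto
    have lohi: "lo m < hi m" for m using bounds[of m] by linarith
    obtain p q where pq: "critical i p q" "\<And>m. m \<noteq> i \<Longrightarrow> p m < lo m" "\<And>m. m \<noteq> i \<Longrightarrow> hi m < q m"
      by (rule critical_box[of "lo i" "hi i" lo hi i, OF lohi lohi order_refl order_refl]) blast
    obtain k'' where k'': "r (k'', q, p)" using critical_reversed[OF pq(1)] by blast
    have w: "p j < b j" "p j < b' j" "a j < q j" "a' j < q j" if "j \<noteq> i" for j
      using pq(2,3)[OF that] bounds[of j] by linarith+
    have "k = k''"
      by (rule reversed_unique_wide[OF c(1) pq(1) _ c(3) k'']) (intro conjI w; assumption)
    moreover have "k' = k''"
      by (rule reversed_unique_wide[OF c(2) pq(1) _ c(4) k'']) (intro conjI w; assumption)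
    ultimately show ?thesis by simp
  qed
  then have uniq: "k' = k" if "critical i a b" "r (k, b, a)" "critical i a' b'" "r (k', b', a')"
    for a b a' b' k k'
    using that(3,1,4,2) .
  show ?thesis
  proof (cases "\<exists>k a b. critical i a b \<and> r (k, b, a)")
    case True
    then obtain k a b where "critical i a b" "r (k, b, a)" by blast
    then have "\<forall>a b k'. critical i a b \<longrightarrow> r (k', b, a) \<longrightarrow> k' = k" by (intro allI impI uniq)
    then show ?thesis by (rule exI)
  qed blast
qed

text \<open>Let \<open>\<tau> i\<close> be the order that reverses the critical pairs for
  \<open>i\<close>. It turns out to be the order by coordinate \<open>i\<close>; hence
  \<open>\<tau>\<close> is injective, and the required permutation is its inverse.\<close>

lemma Rn_is_perm_orders: "\<exists>\<sigma>. bij \<sigma> \<and> r = perm_orders D \<sigma>"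
proof -
  have "\<forall>i. \<exists>t. \<forall>a b k. critical i a b \<longrightarrow> r (k, b, a) \<longrightarrow> k = t"
    using critical_unique_reversed by (rule allI)
  from choice[OF this]
  obtain \<tau> where \<tau>: "\<And>i a b k. critical i a b \<Longrightarrow> r (k, b, a) \<Longrightarrow> k = \<tau> i"
    by blast
  have rev: "r (\<tau> i, b, a)" if "a \<in> D" "b \<in> D" "b i < a i" for a b i
  proof -
    have lt: "(if j = i then b i else max (a j) (b j)) < (if j = i then a i else max (a j) (b j) + 1)" for j
      using that by simp
    \<comment> \<open>The point \<open>c\<close> lies above \<open>b\<close> in the product order
      and makes \<open>a\<close>, \<open>c\<close> a critical pair for \<open>i\<close>, which gives
      the chain \<open>b\<close>, \<open>c\<close>, \<open>a\<close> in the order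
      \<open>\<tau> i\<close>.\<close>
    obtain c where c: "c \<in> D" "\<And>j. (if j = i then b i else max (a j) (b j)) < c j"
      "\<And>j. c j < (if j = i then a i else max (a j) (b j) + 1)"
      by (rule box_obtain[of "\<lambda>j. if j = i then b i else max (a j) (b j)"
            "\<lambda>j. if j = i then a i else max (a j) (b j) + 1", OF lt]) blast
    have ci: "b i < c i" "c i < a i" using c(2,3)[of i] by simp_all
    have cj: "a j < c j" "b j < c j" if "j \<noteq> i" for j using c(2)[of j] that by simp_all
    have crit: "critical i a c" unfolding critical_def using ci cj that c by auto
    obtain k where "r (k, c, a)" using critical_reversed[OF crit] by blast
    then have "r (\<tau> i, c, a)" using \<tau>[OF crit] by blast
    moreover have "b j < c j" for j using ci cj by (cases "j = i") auto
    then have "r (\<tau> i, b, c)" using Rn_prod that c by blast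
    ultimately show ?thesis using Rn_trans that c by blast
  qed
  have iff: "r (\<tau> i, a, b) \<longleftrightarrow> a i < b i" if "a \<in> D" "b \<in> D" for a b i
  proof
    assume *: "r (\<tau> i, a, b)"
    show "a i < b i"
    proof (rule ccontr)
      assume "\<not> a i < b i"
      then consider "a i = b i" | "b i < a i" by linarith
      then show False
      proof cases
        case 1
        then have "a = b" using coord_inj that by blast
        with * Rn_irrefl that show False by blast
      next
        case 2
        then have "r (\<tau> i, b, a)" using rev that by blast
        with * Rn_trans Rn_irrefl that show False by blast
      qed
    qed
  qed (use rev that in blast)
  have "inj \<tau>"
  proof (rule injI)
    fix i j assume "\<tau> i = \<tau> j"
    then have "perm_orders D (\<lambda>_. i) = perm_orders D (\<lambda>_. j)"
      unfolding perm_orders_def using iff[of _ _ i] iff[of _ _ j]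
      by (intro restrict_ext) auto
    then have "(\<lambda>_::'n. i) = (\<lambda>_. j)" by (rule perm_orders_inj)
    then show "i = j" by (rule fun_cong)
  qed
  then have bij: "bij \<tau>" by (simp add: bij_def finite_UNIV_inj_surj)
  have "r = perm_orders D (inv \<tau>)"
  proof (rule extensionalityI)
    show "r \<in> extensional (UNIV \<times> D \<times> D)" using r unfolding Rn_def by blast
    show "perm_orders D (inv \<tau>) \<in> extensional (UNIV \<times> D \<times> D)" unfolding perm_orders_def by simp
    fix x assume "x \<in> (UNIV :: 'n set) \<times> D \<times> D"
    then obtain k a b where x: "x = (k, a, b)" "a \<in> D" "b \<in> D" by auto
    have "\<tau> (inv \<tau> k) = k" using bij by (simp add: bij_is_surj surj_f_inv_f)
    then show "r x = perm_orders D (inv \<tau>) x"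
      using iff[of a b "inv \<tau> k"] x by (simp add: perm_orders_apply)
  qed
  then show ?thesis using bij_imp_bij_inv[OF bij] by blast
qed

end

lemma Rn_eq: "Rn D = perm_orders D ` {\<sigma>. bij \<sigma>}"
  using Rn_is_perm_orders perm_orders_in_Rn by blast

lemma finite_Rn: "finite (Rn D)"
  unfolding Rn_eq by (rule finite_imageI) simp

end

section \<open>The logic action\<close>

text \<open>The restriction makes the inverse extensional, hence a member of \<open>Aut D\<close>
  again.\<close>

definition Aut_inv :: "('n \<Rightarrow> rat) set \<Rightarrow> (('n \<Rightarrow> rat) \<Rightarrow> ('n \<Rightarrow> rat)) \<Rightarrow> ('n \<Rightarrow> rat) \<Rightarrow> ('n \<Rightarrow> rat)" where
  "Aut_inv D g = restrict (inv_into D g) D"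

section \<open>The automorphism group\<close>

lemma Aut_bij: "g \<in> Aut D \<Longrightarrow> bij_betw g D D"
  and Aut_ext: "g \<in> Aut D \<Longrightarrow> g \<in> extensional D"
  and Aut_less: "g \<in> Aut D \<Longrightarrow> a \<in> D \<Longrightarrow> b \<in> D \<Longrightarrow> prod_less (g a) (g b) \<longleftrightarrow> prod_less a b"
  unfolding Aut_def by blast+

lemma Aut_closed: "g \<in> Aut D \<Longrightarrow> x \<in> D \<Longrightarrow> g x \<in> D"
  using Aut_bij bij_betwE by blast

lemma Aut_inv_apply:
  assumes "g \<in> Aut D" "x \<in> D"
  shows "Aut_inv D g x \<in> D" "g (Aut_inv D g x) = x" "Aut_inv D g (g x) = x"
proof -
  have b: "bij_betw g D D" using assms(1) by (rule Aut_bij)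
  show "Aut_inv D g x \<in> D" "g (Aut_inv D g x) = x"
    unfolding Aut_inv_def using b assms(2)
    by (auto simp: bij_betw_def inv_into_into f_inv_into_f)
  show "Aut_inv D g (g x) = x"
    unfolding Aut_inv_def using b assms(2) Aut_closed[OF assms]
    by (simp add: bij_betw_inv_into_left)
qed

lemma AutI:
  assumes "g \<in> extensional D" "\<And>x. x \<in> D \<Longrightarrow> g x \<in> D" "\<And>x. x \<in> D \<Longrightarrow> h x \<in> D"
    "\<And>x. x \<in> D \<Longrightarrow> g (h x) = x" "\<And>x. x \<in> D \<Longrightarrow> h (g x) = x"
    "\<And>a b. a \<in> D \<Longrightarrow> b \<in> D \<Longrightarrow> prod_less a b \<longleftrightarrow> prod_less (g a) (g b)"
  shows "g \<in> Aut D"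
  unfolding Aut_def using assms by (auto intro!: bij_betw_byWitness[where f' = h])

lemma Aut_one_in: "Aut_one D \<in> Aut D"
  by (rule AutI[where h = id]) (auto simp: Aut_one_def)

lemma Aut_inv_in:
  assumes "g \<in> Aut D"
  shows "Aut_inv D g \<in> Aut D"
proof (rule AutI[where h = g])
  fix a b assume "a \<in> D" "b \<in> D"
  then show "prod_less a b \<longleftrightarrow> prod_less (Aut_inv D g a) (Aut_inv D g b)"
    using Aut_less[OF assms, of "Aut_inv D g a" "Aut_inv D g b"] assms by (simp add: Aut_inv_apply)
qed (use assms in \<open>auto simp: Aut_inv_apply Aut_closed\<close>, simp add: Aut_inv_def)

lemma Aut_mult_apply: "x \<in> D \<Longrightarrow> Aut_mult D g h x = g (h x)"
  unfolding Aut_mult_def by simp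

lemma Aut_mult_in:
  assumes "g \<in> Aut D" "h \<in> Aut D"
  shows "Aut_mult D g h \<in> Aut D"
  by (rule AutI[where h = "Aut_mult D (Aut_inv D h) (Aut_inv D g)"])
    (use assms in \<open>auto simp: Aut_mult_apply Aut_closed Aut_inv_apply Aut_less\<close>,
      simp add: Aut_mult_def)

lemma Aut_mult_inv:
  assumes "g \<in> Aut D"
  shows "Aut_mult D g (Aut_inv D g) = Aut_one D" "Aut_mult D (Aut_inv D g) g = Aut_one D"
  using assms unfolding Aut_mult_def Aut_one_def
  by (auto intro!: restrict_ext simp: Aut_inv_apply)

section \<open>Pointwise convergence and its basic neighbourhoods\<close>

lemma topspace_Aut_top: "topspace (Aut_top D) = Aut D"
  unfolding Aut_top_def using Aut_closed Aut_ext by (fastforce simp: PiE_def)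

lemma openin_Aut_agree:
  assumes "finite A" "h \<in> Aut D" "A \<subseteq> D"
  shows "openin (Aut_top D) {g \<in> Aut D. \<forall>x\<in>A. g x = h x}"
proof -
  let ?U = "\<Pi>\<^sub>E x\<in>D. if x \<in> A then {h x} else D"
  have "openin (product_topology (\<lambda>_. discrete_topology D) D) ?U"
    unfolding openin_PiE_gen using assms Aut_closed[OF assms(2)]
    by (intro disjI2 conjI) (auto intro: rev_finite_subset)
  moreover have "{g \<in> Aut D. \<forall>x\<in>A. g x = h x} = ?U \<inter> Aut D"
  proof (intro set_eqI iffI)
    fix g assume "g \<in> {g \<in> Aut D. \<forall>x\<in>A. g x = h x}"
    then show "g \<in> ?U \<inter> Aut D" using Aut_closed[of g D] Aut_ext[of g D] by (simp add: PiE_iff)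
  next
    fix g assume g: "g \<in> ?U \<inter> Aut D"
    have "g x = h x" if "x \<in> A" for x
    proof -
      from g have "g \<in> ?U" by (rule IntD1)
      moreover have "x \<in> D" using that assms(3) by (rule subsetD[rotated])
      ultimately have "g x \<in> (if x \<in> A then {h x} else D)" by (rule PiE_mem)
      with that show ?thesis by simp
    qed
    with g show "g \<in> {g \<in> Aut D. \<forall>x\<in>A. g x = h x}" by simp
  qed
  ultimately show ?thesis unfolding Aut_top_def openin_subtopology by blast
qed

text \<open>A basic neighbourhood of the identity constrains the values at finitely many points
  only, and these form \<open>A\<close>.\<close>

lemma Aut_top_stabilizer_subset:
  assumes "openin (Aut_top D) N" "Aut_one D \<in> N"
  shows "\<exists>A. finite A \<and> A \<subseteq> D \<and> (\<forall>g\<in>Aut D. (\<forall>x\<in>A. g x = x) \<longrightarrow> g \<in> N)"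
proof -
  obtain T where T: "openin (product_topology (\<lambda>_. discrete_topology D) D) T" "N = T \<inter> Aut D"
    using assms(1) unfolding Aut_top_def openin_subtopology by blast
  then have "Aut_one D \<in> T" using assms(2) by blast
  with T(1) have "\<exists>U. finite {x \<in> D. U x \<noteq> D} \<and> (\<forall>x\<in>D. openin (discrete_topology D) (U x)) \<and>
      Aut_one D \<in> Pi\<^sub>E D U \<and> Pi\<^sub>E D U \<subseteq> T"
    unfolding openin_product_topology_alt topspace_discrete_topology by (rule bspec)
  then obtain U where U: "finite {x \<in> D. U x \<noteq> D}" "Aut_one D \<in> Pi\<^sub>E D U" "Pi\<^sub>E D U \<subseteq> T"
    by (elim exE conjE)
  have "g \<in> N" if "g \<in> Aut D" and fixed: "\<And>x. x \<in> {x \<in> D. U x \<noteq> D} \<Longrightarrow> g x = x" for g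
  proof -
    have "g x \<in> U x" if "x \<in> D" for x
    proof (cases "U x = D")
      case True
      then show ?thesis using Aut_closed[OF \<open>g \<in> Aut D\<close> that] by simp
    next
      case False
      then have "g x = x" using fixed that by simp
      moreover have "Aut_one D x \<in> U x" using U(2) that by (rule PiE_mem)
      ultimately show ?thesis using that by (simp add: Aut_one_def)
    qed
    then have "g \<in> Pi\<^sub>E D U" using Aut_ext[OF \<open>g \<in> Aut D\<close>] by (simp add: PiE_iff)
    then show ?thesis using U(3) T(2) \<open>g \<in> Aut D\<close> by blast
  qed
  then show ?thesis
    by (intro exI[of _ "{x \<in> D. U x \<noteq> D}"] conjI ballI impI U(1)) blast+
qed

text \<open>Stated for any flow, since it serves both the logic action and the flows that it is
  mapped to.\<close>

lemma Aut_flow_inv: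
  assumes "is_flow (Aut D) (Aut_mult D) (Aut_one D) T X act" "h \<in> Aut D" "x \<in> topspace X"
  shows "act (Aut_inv D h) (act h x) = x"
proof -
  have "act (Aut_mult D (Aut_inv D h) h) x = act (Aut_inv D h) (act h x)"
    using assms(1,3) Aut_inv_in[OF assms(2)] assms(2) unfolding is_flow_def by simp
  moreover have "act (Aut_one D) x = x" using assms(1,3) unfolding is_flow_def by simp
  ultimately show ?thesis using Aut_mult_inv(2)[OF assms(2)] by simp
qed

section \<open>Action laws and invariance of the set of realizers\<close>

lemma logic_action_ext: "logic_action D g r \<in> extensional (UNIV \<times> D \<times> D)"
  unfolding logic_action_def by simp

lemma logic_action_apply:
  assumes "g \<in> Aut D" "a \<in> D" "b \<in> D"
  shows "logic_action D g r (i, a, b) = r (i, Aut_inv D g a, Aut_inv D g b)"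
  using assms unfolding logic_action_def Aut_inv_def by simp

lemma logic_action_one:
  assumes "r \<in> extensional (UNIV \<times> D \<times> D)"
  shows "logic_action D (Aut_one D) r = r"
proof (rule extensionalityI[OF logic_action_ext assms])
  fix p :: "'a \<times> ('a \<Rightarrow> rat) \<times> ('a \<Rightarrow> rat)" assume "p \<in> UNIV \<times> D \<times> D"
  then obtain i a b where p: "p = (i, a, b)" "a \<in> D" "b \<in> D" by auto
  have "Aut_inv D (Aut_one D) x = x" if "x \<in> D" for x
    using Aut_inv_apply(2)[OF Aut_one_in that] Aut_inv_apply(1)[OF Aut_one_in that]
    by (simp add: Aut_one_def)
  then show "logic_action D (Aut_one D) r p = r p"
    using p logic_action_apply[OF Aut_one_in p(2,3)] by simp
qed

lemma logic_action_mult: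
  assumes "g \<in> Aut D" "h \<in> Aut D"
  shows "logic_action D (Aut_mult D g h) r = logic_action D g (logic_action D h r)"
proof (rule extensionalityI[OF logic_action_ext logic_action_ext])
  fix p :: "'a \<times> ('a \<Rightarrow> rat) \<times> ('a \<Rightarrow> rat)" assume "p \<in> UNIV \<times> D \<times> D"
  then obtain i a b where p: "p = (i, a, b)" "a \<in> D" "b \<in> D" by auto
  have "Aut_inv D (Aut_mult D g h) x = Aut_inv D h (Aut_inv D g x)" if "x \<in> D" for x
    using Aut_inv_apply(3)[OF Aut_mult_in[OF assms], of "Aut_inv D h (Aut_inv D g x)"] that assms
    by (simp add: Aut_mult_apply Aut_inv_apply)
  then show "logic_action D (Aut_mult D g h) r p = logic_action D g (logic_action D h r) p"
    using p assms logic_action_apply[OF Aut_mult_in[OF assms] p(2,3)] logic_action_apply[OF assms(1) p(2,3)]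
      logic_action_apply[OF assms(2) Aut_inv_apply(1)[OF assms(1) p(2)] Aut_inv_apply(1)[OF assms(1) p(3)]]
    by simp
qed

lemma logic_action_Rn:
  assumes g: "g \<in> Aut D" and r: "r \<in> Rn D"
  shows "logic_action D g r \<in> Rn D"
proof -
  have lin: "strict_linear_order_on D (\<lambda>a b. r (i, a, b))" for i using r unfolding Rn_def by blast
  have inj: "Aut_inv D g a \<noteq> Aut_inv D g b" if "a \<in> D" "b \<in> D" "a \<noteq> b" for a b
    using that Aut_inv_apply(2)[OF g] by metis
  have "strict_linear_order_on D (\<lambda>a b. r (i, Aut_inv D g a, Aut_inv D g b))" for i
    using lin[of i] Aut_inv_apply(1)[OF g] inj unfolding strict_linear_order_on_def by metis
  then have "strict_linear_order_on D (\<lambda>a b. logic_action D g r (i, a, b))" for i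
    using logic_action_apply[OF g] unfolding strict_linear_order_on_def by (metis (no_types, lifting))
  moreover have "prod_less a b \<longleftrightarrow> (\<forall>i. logic_action D g r (i, a, b))" if "a \<in> D" "b \<in> D" for a b
  proof -
    have "prod_less a b \<longleftrightarrow> prod_less (Aut_inv D g a) (Aut_inv D g b)"
      using Aut_less[OF Aut_inv_in[OF g] that] by simp
    also have "\<dots> \<longleftrightarrow> (\<forall>i. r (i, Aut_inv D g a, Aut_inv D g b))"
      using r Aut_inv_apply(1)[OF g] that unfolding Rn_def by blast
    finally show ?thesis using logic_action_apply[OF g that] by simp
  qed
  ultimately show ?thesis unfolding Rn_def using logic_action_ext by blast
qed

section \<open>The finite flow of realizers and its minimality\<close>

context generic_dense
begin

text \<open>A finite subspace of a T1 space is discrete; this makes every map from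
  \<open>Rn D\<close> into a space continuous.\<close>

lemma Rn_top_discrete: "Rn_top D = discrete_topology (Rn D)"
proof -
  have "Rn D \<subseteq> topspace (product_topology (\<lambda>_. discrete_topology UNIV) (UNIV \<times> D \<times> D))"
    unfolding Rn_def by (auto simp: PiE_def)
  moreover have "t1_space (product_topology (\<lambda>_. discrete_topology (UNIV::bool set)) ((UNIV::'n set) \<times> D \<times> D))"
    by (rule Hausdorff_imp_t1_space) (simp add: Hausdorff_space_product_topology)
  ultimately show ?thesis
    unfolding Rn_top_def using finite_Rn by (simp add: subtopology_eq_discrete_topology_finite)
qed

text \<open>Each entry of the new tuple depends on \<open>g\<close> only through the preimages of
  two points. It is therefore unchanged when \<open>g\<close> is replaced by any \<open>h\<close>
  that agrees with it at these preimages.\<close>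

lemma logic_action_continuous:
  "continuous_map (prod_topology (Aut_top D) (Rn_top D)) (Rn_top D) (\<lambda>(g, r). logic_action D g r)"
proof -
  let ?X = "prod_topology (Aut_top D) (Rn_top D)"
  have X: "topspace ?X = Aut D \<times> Rn D"
    by (simp add: topspace_Aut_top Rn_top_discrete)
  have "continuous_map ?X (discrete_topology UNIV) (\<lambda>p. (case p of (g, r) \<Rightarrow> logic_action D g r) (i, a, b))"
    if ab: "a \<in> D" "b \<in> D" for i a b
  proof -
    have "openin ?X {p \<in> topspace ?X. (case p of (g, r) \<Rightarrow> logic_action D g r) (i, a, b) \<in> S}" for S
      unfolding openin_prod_topology_alt
    proof (intro allI impI)
      fix g r assume "(g, r) \<in> {p \<in> topspace ?X. (case p of (g, r) \<Rightarrow> logic_action D g r) (i, a, b) \<in> S}"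
      then have g: "g \<in> Aut D" and r: "r \<in> Rn D" and S: "logic_action D g r (i, a, b) \<in> S"
        using X by auto
      define A where "A = {Aut_inv D g a, Aut_inv D g b}"
      have A: "finite A" "A \<subseteq> D" unfolding A_def using Aut_inv_apply(1)[OF g] ab by auto
      let ?U = "{h \<in> Aut D. \<forall>x\<in>A. h x = g x}"
      have "logic_action D h r (i, a, b) = logic_action D g r (i, a, b)" if h: "h \<in> ?U" for h
      proof -
        have "Aut_inv D h x = Aut_inv D g x" if "Aut_inv D g x \<in> A" "x \<in> D" for x
          using h that Aut_inv_apply[OF g that(2)] Aut_inv_apply(3)[of h D "Aut_inv D g x"] by auto
        then have "Aut_inv D h a = Aut_inv D g a" "Aut_inv D h b = Aut_inv D g b"
          using ab by (simp_all add: A_def)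
        moreover have "h \<in> Aut D" using h by simp
        ultimately show ?thesis using logic_action_apply[OF _ ab] g by metis
      qed
      then have "?U \<times> {r} \<subseteq> {p \<in> topspace ?X. (case p of (g, r) \<Rightarrow> logic_action D g r) (i, a, b) \<in> S}"
        using S X r by auto
      moreover have "openin (Rn_top D) {r}" using r by (simp add: Rn_top_discrete)
      ultimately show "\<exists>U V. openin (Aut_top D) U \<and> openin (Rn_top D) V \<and> g \<in> U \<and> r \<in> V \<and>
          U \<times> V \<subseteq> {p \<in> topspace ?X. (case p of (g, r) \<Rightarrow> logic_action D g r) (i, a, b) \<in> S}"
        using openin_Aut_agree[OF A(1) g A(2)] g
        by (intro exI[of _ ?U] exI[of _ "{r}"] conjI) auto
    qed
    then show ?thesis unfolding continuous_map_def by (auto simp only: topspace_discrete_topology UNIV_I Pi_I)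
  qed
  then have "continuous_map ?X (product_topology (\<lambda>_. discrete_topology UNIV) (UNIV \<times> D \<times> D))
      (\<lambda>(g, r). logic_action D g r)"
    unfolding continuous_map_componentwise using logic_action_ext by auto
  moreover have "(\<lambda>(g, r). logic_action D g r) \<in> topspace ?X \<rightarrow> Rn D"
    unfolding X using logic_action_Rn by auto
  ultimately have "continuous_map ?X (subtopology (product_topology (\<lambda>_. discrete_topology UNIV) (UNIV \<times> D \<times> D)) (Rn D))
      (\<lambda>(g, r). logic_action D g r)"
    unfolding continuous_map_in_subtopology by (rule conjI)
  then show ?thesis by (simp only: flip: Rn_top_def)
qed

lemma logic_action_flow:
  "is_flow (Aut D) (Aut_mult D) (Aut_one D) (Aut_top D) (Rn_top D) (logic_action D)"
  unfolding is_flow_def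
proof (intro conjI ballI)
  show "compact_space (Rn_top D)" "Hausdorff_space (Rn_top D)"
    using finite_Rn by (simp_all add: Rn_top_discrete compact_space_discrete_topology)
  show "continuous_map (prod_topology (Aut_top D) (Rn_top D)) (Rn_top D) (\<lambda>(g, r). logic_action D g r)"
    by (rule logic_action_continuous)
next
  fix r assume "r \<in> topspace (Rn_top D)"
  then show "logic_action D (Aut_one D) r = r"
    by (intro logic_action_one) (simp add: Rn_top_discrete Rn_def)
qed (simp_all add: Rn_top_discrete logic_action_Rn logic_action_mult)

text \<open>The product order is the intersection of all coordinate orders, and a permutation of
  these has the same intersection.\<close>

lemma perm_aut_subset: "bij \<sigma> \<Longrightarrow> perm_aut D \<sigma> \<subseteq> Aut D"
proof
  fix g assume \<sigma>: "bij \<sigma>" and g: "g \<in> perm_aut D \<sigma>"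
  then have b: "bij_betw g D D" and e: "coord_emb \<sigma> D g" and x: "g \<in> extensional D"
    unfolding perm_aut_def by auto
  have "prod_less a b \<longleftrightarrow> prod_less (g a) (g b)" if "a \<in> D" "b \<in> D" for a b
  proof -
    have "prod_less (g a) (g b) \<longleftrightarrow> (\<forall>i. g a i < g b i)"
      using that b by (simp add: prod_less_iff bij_betwE)
    also have "\<dots> \<longleftrightarrow> (\<forall>i. g a (\<sigma> i) < g b (\<sigma> i))"
      using bij_is_surj[OF \<sigma>] by (metis surjD)
    also have "\<dots> \<longleftrightarrow> prod_less a b"
      using e that by (simp add: prod_less_iff coord_emb_def)
    finally show ?thesis by simp
  qed
  then show "g \<in> Aut D" unfolding Aut_def using b x by blast
qed

lemma logic_action_perm_aut:
  assumes "bij \<sigma>" "g \<in> perm_aut D \<sigma>"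
  shows "logic_action D g (perm_orders D id) = perm_orders D \<sigma>"
proof (rule extensionalityI[OF logic_action_ext])
  show "perm_orders D \<sigma> \<in> extensional (UNIV \<times> D \<times> D)" unfolding perm_orders_def by simp
  have g: "g \<in> Aut D" using assms perm_aut_subset by blast
  fix p :: "'n \<times> ('n \<Rightarrow> rat) \<times> ('n \<Rightarrow> rat)" assume "p \<in> UNIV \<times> D \<times> D"
  then obtain i a b where p: "p = (i, a, b)" "a \<in> D" "b \<in> D" by auto
  have "coord_emb \<sigma> D g" using assms unfolding perm_aut_def by blast
  then have "Aut_inv D g a i < Aut_inv D g b i \<longleftrightarrow> a (\<sigma> i) < b (\<sigma> i)"
    unfolding coord_emb_def using p Aut_inv_apply[OF g] by metis
  then show "logic_action D g (perm_orders D id) p = perm_orders D \<sigma> p"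
    using p g 
      logic_action_apply[OF g p(2,3), of "perm_orders D id" i]
    by (simp add: perm_orders_apply Aut_inv_apply)
qed

lemma logic_action_fix_imp:
  assumes g: "g \<in> Aut D" and fixed: "logic_action D g (perm_orders D id) = perm_orders D id"
  shows "g \<in> perm_aut D id"
proof -
  have "coord_emb id D g"
    unfolding coord_emb_def
  proof (intro ballI allI)
    fix x y i assume xy: "x \<in> D" "y \<in> D"
    then have "logic_action D g (perm_orders D id) (i, g x, g y) = perm_orders D id (i, x, y)"
      using logic_action_apply[OF g Aut_closed[OF g xy(1)] Aut_closed[OF g xy(2)]] g
      by (simp add: Aut_inv_apply)
    then show "x i < y i \<longleftrightarrow> g x (id i) < g y (id i)"
      unfolding fixed using xy g by (simp add: perm_orders_apply Aut_closed)
  qed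
  then show ?thesis unfolding perm_aut_def using Aut_bij[OF g] Aut_ext[OF g] by blast
qed

text \<open>Back-and-forth from the empty map shows that \<open>perm_aut D \<sigma>\<close> is
  nonempty for every permutation \<open>\<sigma>\<close>.\<close>

lemma logic_action_transitive:
  assumes "r \<in> Rn D"
  shows "\<exists>g\<in>Aut D. logic_action D g (perm_orders D id) = r"
proof -
  obtain \<sigma> where \<sigma>: "bij \<sigma>" "r = perm_orders D \<sigma>" using assms Rn_eq by blast
  obtain g where "g \<in> perm_aut D \<sigma>"
    using back_and_forth[OF \<sigma>(1), of "{}" id] by (auto simp: coord_emb_def)
  then show ?thesis using \<sigma> logic_action_perm_aut perm_aut_subset by blast
qed

lemma logic_action_minimal:
  "is_minimal_flow (Aut D) (Aut_mult D) (Aut_one D) (Aut_top D) (Rn_top D) (logic_action D)"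
  unfolding is_minimal_flow_def
proof (intro conjI ballI)
  show "is_flow (Aut D) (Aut_mult D) (Aut_one D) (Aut_top D) (Rn_top D) (logic_action D)"
    by (rule logic_action_flow)
  show "topspace (Rn_top D) \<noteq> {}"
    using perm_orders_in_Rn[OF bij_id] by (auto simp: Rn_top_discrete)
next
  fix r assume "r \<in> topspace (Rn_top D)"
  then have r: "r \<in> Rn D" by (simp add: Rn_top_discrete)
  then obtain h where h: "h \<in> Aut D" "logic_action D h (perm_orders D id) = r"
    using logic_action_transitive by blast
  have "Rn D \<subseteq> (\<lambda>g. logic_action D g r) ` Aut D"
  proof
    fix s assume "s \<in> Rn D"
    then obtain g where g: "g \<in> Aut D" "logic_action D g (perm_orders D id) = s"
      using logic_action_transitive by blast
    have "logic_action D (Aut_inv D h) r = perm_orders D id"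
      using Aut_flow_inv[OF logic_action_flow h(1), of "perm_orders D id"] h(2)
        perm_orders_in_Rn[OF bij_id] by (simp add: Rn_top_discrete)
    then have "logic_action D (Aut_mult D g (Aut_inv D h)) r = s"
      using g h by (simp add: logic_action_mult Aut_inv_in)
    then show "s \<in> (\<lambda>g. logic_action D g r) ` Aut D"
      using Aut_mult_in[OF g(1) Aut_inv_in[OF h(1)]] by blast
  qed
  then have "(\<lambda>g. logic_action D g r) ` Aut D = Rn D"
    using logic_action_Rn r by blast
  then have "(\<lambda>g. logic_action D g r) ` Aut D = topspace (Rn_top D)" by (simp add: Rn_top_discrete)
  then show "Rn_top D closure_of (\<lambda>g. logic_action D g r) ` Aut D = topspace (Rn_top D)"
    by (simp only: closure_of_topspace)
qed

end

section \<open>Ramsey argument and fixed points\<close>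

definition coord_index :: "'n::finite \<Rightarrow> nat" where
  "coord_index = (SOME f. inj f)"

lemma inj_coord_index: "inj coord_index"
proof -
  obtain f :: "'a \<Rightarrow> nat" where "inj f"
    using finite_imp_inj_to_nat_seg[of "UNIV :: 'a set"] by auto
  then show ?thesis unfolding coord_index_def by (rule someI[of inj])
qed

text \<open>Lexicographic order on the pairs of a coordinate and a point: points are compared within a
  coordinate, so that each coordinate is a block of consecutive elements.\<close>

definition block_less :: "'n::finite \<times> ('n \<Rightarrow> rat) \<Rightarrow> 'n \<times> ('n \<Rightarrow> rat) \<Rightarrow> bool" where
  "block_less p q \<longleftrightarrow> coord_index (fst p) < coord_index (fst q) \<or>
     fst p = fst q \<and> snd p (fst p) < snd q (fst q)"

text \<open>Such a \<open>\<psi>\<close> codes a copy of \<open>A\<close> in which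
  \<open>\<psi> (i, x)\<close> governs coordinate \<open>i\<close> of the image of \<open>x\<close>.
  As the coordinates occupy consecutive blocks, the set of values alone determines
  \<open>\<psi>\<close> on \<open>A\<close>, so colouring copies amounts to colouring sets.\<close>

definition block_mono :: "('n::finite \<Rightarrow> rat) set \<Rightarrow> ('n \<times> ('n \<Rightarrow> rat) \<Rightarrow> nat) \<Rightarrow> bool" where
  "block_mono A \<psi> \<longleftrightarrow> (\<forall>p\<in>UNIV \<times> A. \<forall>q\<in>UNIV \<times> A. block_less p q \<longrightarrow> \<psi> p < \<psi> q)"

lemma block_monoD:
  "block_mono A \<psi> \<Longrightarrow> p \<in> UNIV \<times> A \<Longrightarrow> q \<in> UNIV \<times> A \<Longrightarrow> block_less p q \<Longrightarrow> \<psi> p < \<psi> q"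
  unfolding block_mono_def by blast

lemma block_less_irrefl: "\<not> block_less p p"
  unfolding block_less_def by simp

lemma block_less_trans: "block_less p q \<Longrightarrow> block_less q s \<Longrightarrow> block_less p s"
  unfolding block_less_def by auto

text \<open>The number of predecessors is a strictly increasing rank.\<close>

lemma block_mono_exists:
  assumes "finite B"
  shows "\<exists>\<kappa>. block_mono B \<kappa>"
proof
  show "block_mono B (\<lambda>p. card {q \<in> UNIV \<times> B. block_less q p})"
    unfolding block_mono_def
  proof (intro ballI impI psubset_card_mono)
    fix p q assume p: "p \<in> (UNIV :: 'a set) \<times> B" and pq: "block_less p q"
    show "finite {s \<in> UNIV \<times> B. block_less s q}" using assms by simp
    have "{s \<in> UNIV \<times> B. block_less s p} \<subseteq> {s \<in> UNIV \<times> B. block_less s q}"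
      using block_less_trans[OF _ pq] by auto
    moreover have "p \<in> {s \<in> UNIV \<times> B. block_less s q}" using p pq by simp
    moreover have "p \<notin> {s \<in> UNIV \<times> B. block_less s p}" by (simp add: block_less_irrefl)
    ultimately show "{s \<in> UNIV \<times> B. block_less s p} \<subset> {s \<in> UNIV \<times> B. block_less s q}" by blast
  qed
qed

section \<open>Copies of finite sets coded by sets of naturals\<close>

context generic_dense
begin

lemma block_less_total:
  assumes "p \<in> UNIV \<times> D" "q \<in> UNIV \<times> D" "p \<noteq> q"
  shows "block_less p q \<or> block_less q p"
proof (cases "fst p = fst q")
  case True
  then have "snd p \<noteq> snd q" using assms(3) by (simp add: prod_eq_iff)
  moreover have "snd p \<in> D" "snd q \<in> D" using assms by auto
  ultimately have "snd p (fst p) \<noteq> snd q (fst p)" using coord_inj by blast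
  with True show ?thesis unfolding block_less_def by auto
next
  case False
  then have "coord_index (fst p) \<noteq> coord_index (fst q)" by (simp add: inj_eq[OF inj_coord_index])
  then show ?thesis unfolding block_less_def by auto
qed

lemma block_mono_iff:
  assumes "A \<subseteq> D" "block_mono A \<psi>" "p \<in> UNIV \<times> A" "q \<in> UNIV \<times> A"
  shows "\<psi> p < \<psi> q \<longleftrightarrow> block_less p q"
proof
  assume lt: "\<psi> p < \<psi> q"
  then have "p \<noteq> q" by auto
  moreover have "\<not> block_less q p"
    using block_monoD[OF assms(2,4,3)] lt by auto
  moreover have "p \<in> UNIV \<times> D" "q \<in> UNIV \<times> D" using assms by auto
  ultimately show "block_less p q" using block_less_total by blast
qed (rule block_monoD[OF assms(2,3,4)])

lemma block_mono_inj:
  assumes "A \<subseteq> D" "block_mono A \<psi>"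
  shows "inj_on \<psi> (UNIV \<times> A)"
proof (rule inj_onI, rule ccontr)
  fix p q assume pq: "p \<in> (UNIV :: 'n set) \<times> A" "q \<in> (UNIV :: 'n set) \<times> A" "\<psi> p = \<psi> q" "p \<noteq> q"
  moreover have "p \<in> UNIV \<times> D" "q \<in> UNIV \<times> D" using pq assms by auto
  ultimately have "block_less p q \<or> block_less q p" using block_less_total by blast
  then show False using block_monoD[OF assms(2)] pq by (metis less_irrefl)
qed

text \<open>\<open>\<psi> p\<close> has as many smaller elements in the image as \<open>p\<close>
  has predecessors, and an element of a finite set of naturals is determined by this number.\<close>

lemma block_mono_unique:
  assumes A: "finite A" "A \<subseteq> D" and \<psi>: "block_mono A \<psi>" "block_mono A \<psi>'"
    and im: "\<psi> ` (UNIV \<times> A) = \<psi>' ` (UNIV \<times> A)" and p: "p \<in> UNIV \<times> A"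
  shows "\<psi> p = \<psi>' p"
proof -
  have count: "card {s \<in> \<phi> ` (UNIV \<times> A). s < \<phi> p} = card {q \<in> UNIV \<times> A. block_less q p}"
    if \<phi>: "block_mono A \<phi>" for \<phi>
  proof -
    have "{s \<in> \<phi> ` (UNIV \<times> A). s < \<phi> p} = \<phi> ` {q \<in> UNIV \<times> A. block_less q p}"
      using block_mono_iff[OF A(2) \<phi> _ p] by blast
    moreover have "inj_on \<phi> {q \<in> UNIV \<times> A. block_less q p}"
      using block_mono_inj[OF A(2) \<phi>] by (rule inj_on_subset) blast
    ultimately show ?thesis by (simp add: card_image)
  qed
  have strict: "card {s \<in> S. s < a} < card {s \<in> S. s < b}" if "a < b" "a \<in> S" "finite S" for S and a b :: nat
    using that by (intro psubset_card_mono) auto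
  define S where "S = \<psi> ` (UNIV \<times> A)"
  have "finite S" unfolding S_def using A(1) by simp
  moreover have "\<psi> p \<in> S" "\<psi>' p \<in> S" using p im unfolding S_def by blast+
  moreover have "card {s \<in> S. s < \<psi> p} = card {s \<in> S. s < \<psi>' p}"
    using count[OF \<psi>(1)] count[OF \<psi>(2)] unfolding S_def im by simp
  ultimately show ?thesis
    using strict[of "\<psi> p" "\<psi>' p" S] strict[of "\<psi>' p" "\<psi> p" S] by (cases "\<psi> p" "\<psi>' p" rule: linorder_cases) auto
qed

text \<open>A substitute in \<open>D\<close> for the integer lattice, which general position
  excludes: a point of the unit cube with lowest corner \<open>p\<close>.\<close>

definition grid :: "('n \<Rightarrow> nat) \<Rightarrow> 'n \<Rightarrow> rat" where
  "grid p = (SOME x. x \<in> D \<and> (\<forall>i. of_nat (p i) < x i \<and> x i < of_nat (p i) + 1))"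

lemma grid: "grid p \<in> D" "of_nat (p i) < grid p i" "grid p i < of_nat (p i) + 1"
proof -
  have "\<exists>x. x \<in> D \<and> (\<forall>i. of_nat (p i) < x i \<and> x i < of_nat (p i) + 1)"
    using box[of "\<lambda>i. of_nat (p i)" "\<lambda>i. of_nat (p i) + 1"] by auto
  from someI_ex[OF this] show "grid p \<in> D" "of_nat (p i) < grid p i" "grid p i < of_nat (p i) + 1"
    unfolding grid_def by auto
qed

lemma grid_less:
  assumes "p i < q i"
  shows "grid p i < grid q i"
proof -
  have "grid p i < of_nat (p i) + 1" by (rule grid)
  also have "\<dots> \<le> of_nat (q i)" using assms by (metis Suc_leI of_nat_Suc of_nat_le_iff add.commute)
  also have "\<dots> < grid q i" by (rule grid)
  finally show ?thesis .
qed

text \<open>One direction suffices because each coordinate orders \<open>D\<close> linearly.\<close>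

lemma coord_embI:
  assumes "A \<subseteq> D" "\<And>x y i. x \<in> A \<Longrightarrow> y \<in> A \<Longrightarrow> x i < y i \<Longrightarrow> f x i < f y i"
  shows "coord_emb id A f"
  unfolding coord_emb_def
proof (intro ballI allI iffI)
  fix x y i assume xy: "x \<in> A" "y \<in> A" and less: "f x (id i) < f y (id i)"
  show "x i < y i"
  proof (rule ccontr)
    assume "\<not> x i < y i"
    then consider "x i = y i" | "y i < x i" by linarith
    then show False
    proof cases
      case 1
      then have "x = y" using coord_inj xy assms(1) by blast
      with less show False by simp
    next
      case 2
      with assms(2)[OF xy(2,1)] less show False by fastforce
    qed
  qed
qed (use assms in simp)

lemma coord_emb_grid:
  assumes "A \<subseteq> D" "block_mono A \<psi>"
  shows "coord_emb id A (\<lambda>x. grid (\<lambda>i. \<psi> (i, x)))"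
proof (rule coord_embI[OF assms(1)])
  fix x y i assume "x \<in> A" "y \<in> A" "x i < y i"
  then have "\<psi> (i, x) < \<psi> (i, y)"
    by (intro block_monoD[OF assms(2)]) (auto simp: block_less_def)
  then show "grid (\<lambda>i. \<psi> (i, x)) i < grid (\<lambda>i. \<psi> (i, y)) i"
    by (rule grid_less)
qed

lemma ramsey_embeddings:
  fixes col :: "(('n \<Rightarrow> rat) \<Rightarrow> ('n \<Rightarrow> rat)) \<Rightarrow> 'c"
  assumes A: "finite A" "A \<subseteq> D"
    and F: "finite F" "\<And>f. f \<in> F \<Longrightarrow> f ` A \<subseteq> D \<and> coord_emb id A f"
    and col: "finite J" "\<And>f. f ` A \<subseteq> D \<Longrightarrow> coord_emb id A f \<Longrightarrow> col f \<in> J"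
    and cong: "\<And>f f'. (\<And>x. x \<in> A \<Longrightarrow> f x = f' x) \<Longrightarrow> col f = col f'"
  shows "\<exists>e\<in>perm_aut D id. \<exists>j. \<forall>f\<in>F. col (e \<circ> f) = j"
proof -
  let ?K = "(UNIV :: 'n set) \<times> A"
  define emb where "emb \<psi> x = grid (\<lambda>i. \<psi> (i, x))" for \<psi> :: "'n \<times> ('n \<Rightarrow> rat) \<Rightarrow> nat" and x
  obtain code :: "'c \<Rightarrow> nat" and N where code: "inj_on code J" "code ` J = {i. i < N}"
    using finite_imp_inj_to_nat_seg[OF col(1)] by blast
  \<comment> \<open>The choice of \<open>\<psi>\<close> is harmless by
    \<open>block_mono_unique\<close>, since colours depend on the restriction to \<open>A\<close>
    only; sets that code no copy get the colour 0.\<close>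
  define c where "c S = (if \<exists>\<psi>. block_mono A \<psi> \<and> \<psi> ` ?K = S
     then code (col (emb (SOME \<psi>. block_mono A \<psi> \<and> \<psi> ` ?K = S))) else 0)" for S
  have emb_J: "col (emb \<psi>) \<in> J" if "block_mono A \<psi>" for \<psi>
  proof (rule col(2))
    show "emb \<psi> ` A \<subseteq> D" using grid(1) unfolding emb_def by blast
    show "coord_emb id A (emb \<psi>)" using coord_emb_grid[OF A(2) that] unfolding emb_def .
  qed
  have c_eq: "c (\<psi> ` ?K) = code (col (emb \<psi>))" if \<psi>: "block_mono A \<psi>" for \<psi>
  proof -
    let ?\<phi> = "SOME \<phi>. block_mono A \<phi> \<and> \<phi> ` ?K = \<psi> ` ?K"
    have ex: "\<exists>\<phi>. block_mono A \<phi> \<and> \<phi> ` ?K = \<psi> ` ?K" using \<psi> by blast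
    from someI_ex[OF this] have \<phi>: "block_mono A ?\<phi>" "?\<phi> ` ?K = \<psi> ` ?K" by simp_all
    have "col (emb ?\<phi>) = col (emb \<psi>)"
    proof (rule cong)
      fix x assume "x \<in> A"
      then have "?\<phi> (i, x) = \<psi> (i, x)" for i
        by (intro block_mono_unique[OF A \<phi>(1) \<psi> \<phi>(2)]) simp
      then show "emb ?\<phi> x = emb \<psi> x" unfolding emb_def by simp
    qed
    then show ?thesis unfolding c_def using ex by simp
  qed
  \<comment> \<open>The bound \<open>Suc N\<close> leaves room for the default colour 0 even if
    \<open>N = 0\<close>.\<close>
  have c_less: "c S < Suc N" for S
  proof (cases "\<exists>\<psi>. block_mono A \<psi> \<and> \<psi> ` ?K = S")
    case True
    then obtain \<psi> where "block_mono A \<psi>" "S = \<psi> ` ?K" by blast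
    then have "c S = code (col (emb \<psi>))" "col (emb \<psi>) \<in> J" using c_eq emb_J by auto
    then have "c S \<in> {i. i < N}" using code(2) by (metis imageI)
    then show ?thesis by simp
  next
    case False
    then have "c S = 0" unfolding c_def by (rule if_not_P)
    then show ?thesis by simp
  qed
  have "\<exists>Y t. Y \<subseteq> (UNIV :: nat set) \<and> infinite Y \<and> t < Suc N \<and>
      (\<forall>X. X \<subseteq> Y \<and> finite X \<and> card X = card ?K \<longrightarrow> c X = t)"
    by (rule Ramsey) (use c_less in auto)
  then obtain Y t where Y: "infinite Y" "\<forall>X. X \<subseteq> Y \<and> finite X \<and> card X = card ?K \<longrightarrow> c X = t"
    by (elim exE conjE)
  define B where "B = (\<Union>f\<in>F. f ` A)"
  have B: "finite B" "B \<subseteq> D" unfolding B_def using F A by auto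
  obtain \<kappa> where \<kappa>: "block_mono B \<kappa>" using block_mono_exists[OF B(1)] by blast
  define \<psi> where "\<psi> p = enumerate Y (\<kappa> p)" for p
  have \<psi>: "block_mono B \<psi>"
    using \<kappa> enumerate_mono[OF _ Y(1)] unfolding block_mono_def \<psi>_def by blast
  have "emb \<psi> ` B \<subseteq> D" unfolding emb_def using grid(1) by (rule image_subsetI)
  moreover have "coord_emb id B (emb \<psi>)" unfolding emb_def by (rule coord_emb_grid[OF B(2) \<psi>])
  ultimately have "\<exists>e\<in>perm_aut D id. \<forall>x\<in>B. e x = emb \<psi> x" by (rule back_and_forth[OF bij_id B])
  then obtain e where e: "e \<in> perm_aut D id" "\<And>x. x \<in> B \<Longrightarrow> e x = emb \<psi> x" by blast
  have "code (col (e \<circ> f)) = t \<and> col (e \<circ> f) \<in> J" if f: "f \<in> F" for f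
  proof -
    \<comment> \<open>The code of \<open>e \<circ> f\<close> is the code of the large copy pulled
      back along \<open>f\<close>, which respects the blocks because \<open>f\<close> preserves
      every coordinate order.\<close>
    define \<phi> where "\<phi> p = \<psi> (fst p, f (snd p))" for p
    have fB: "f x \<in> B" if "x \<in> A" for x using f that unfolding B_def by blast
    have "block_mono A \<phi>"
      unfolding block_mono_def
    proof (intro ballI impI)
      fix p q assume pq: "p \<in> ?K" "q \<in> ?K" "block_less p q"
      have "coord_emb id A f" using F(2) f by blast
      moreover have "snd p \<in> A" "snd q \<in> A" using pq by auto
      ultimately have "block_less (fst p, f (snd p)) (fst q, f (snd q))"
        using pq(3) unfolding block_less_def coord_emb_def by auto
      then show "\<phi> p < \<phi> q"
        unfolding \<phi>_def using pq fB by (intro block_monoD[OF \<psi>]) auto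
    qed
    moreover have "\<phi> ` ?K \<subseteq> Y" unfolding \<phi>_def \<psi>_def using enumerate_in_set[OF Y(1)] by blast
    moreover have "card (\<phi> ` ?K) = card ?K"
      by (rule card_image[OF block_mono_inj[OF A(2)]]) fact
    ultimately have "code (col (emb \<phi>)) = t" "col (emb \<phi>) \<in> J"
      using Y(2)[rule_format, of "\<phi> ` ?K"] c_eq[of \<phi>] emb_J A(1) by auto
    moreover have "col (e \<circ> f) = col (emb \<phi>)"
      by (rule cong) (use e(2) fB in \<open>simp add: emb_def \<phi>_def\<close>)
    ultimately show ?thesis by simp
  qed
  then have "col (e \<circ> f) = inv_into J code t" if "f \<in> F" for f
    using that code(1) inv_into_f_eq by metis
  then show ?thesis using e(1) by blast
qed

section \<open>Fixed points of the stabilizer of the coordinate orders\<close>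

lemma perm_aut_id_inv:
  assumes "g \<in> perm_aut D id"
  shows "Aut_inv D g \<in> perm_aut D id"
proof -
  have g: "g \<in> Aut D" using assms perm_aut_subset[OF bij_id] by blast
  then have "Aut_inv D g \<in> Aut D" by (rule Aut_inv_in)
  moreover have "coord_emb id D (Aut_inv D g)"
    unfolding coord_emb_def
  proof (intro ballI allI)
    fix x y i assume xy: "x \<in> D" "y \<in> D"
    have "Aut_inv D g x i < Aut_inv D g y i \<longleftrightarrow> g (Aut_inv D g x) (id i) < g (Aut_inv D g y) (id i)"
      using assms xy Aut_inv_apply(1)[OF g] unfolding perm_aut_def coord_emb_def by simp
    then show "x i < y i \<longleftrightarrow> Aut_inv D g x (id i) < Aut_inv D g y (id i)"
      using xy g by (simp add: Aut_inv_apply)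
  qed
  ultimately show ?thesis unfolding perm_aut_def by (simp add: Aut_bij Aut_ext)
qed

lemma perm_aut_id_mult:
  assumes "g \<in> perm_aut D id" "h \<in> perm_aut D id"
  shows "Aut_mult D g h \<in> perm_aut D id"
proof -
  have gh: "g \<in> Aut D" "h \<in> Aut D" using assms perm_aut_subset[OF bij_id] by blast+
  have "coord_emb id D (Aut_mult D g h)"
    using assms Aut_closed[OF gh(2)] unfolding perm_aut_def coord_emb_def by (simp add: Aut_mult_apply)
  with Aut_mult_in[OF gh] show ?thesis unfolding perm_aut_def by (simp add: Aut_bij Aut_ext)
qed

text \<open>Separating \<open>y\<close> from \<open>act h y\<close> gives \<open>V\<close>;
  continuity of the action at the identity and \<open>y\<close> gives \<open>W\<close> and
  \<open>A\<close>. The passage from \<open>W\<close> to \<open>V\<close> absorbs the freedom left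
  when only the effect of an automorphism on \<open>A\<close> is known.\<close>

lemma flow_moved_nbhd:
  assumes flow: "is_flow (Aut D) (Aut_mult D) (Aut_one D) (Aut_top D) Y act"
    and h: "h \<in> Aut D" and y: "y \<in> topspace Y" "act h y \<noteq> y"
  shows "\<exists>W V A. y \<in> W \<and> openin Y W \<and> finite A \<and> A \<subseteq> D \<and> (\<forall>z\<in>V. act h z \<notin> V) \<and>
    (\<forall>g\<in>Aut D. (\<forall>x\<in>A. g x = x) \<longrightarrow> (\<forall>z\<in>W. act g z \<in> V))"
proof -
  let ?P = "prod_topology (Aut_top D) Y"
  have cont: "continuous_map ?P Y (\<lambda>(g, x). act g x)" and haus: "Hausdorff_space Y"
    and one: "act (Aut_one D) y = y" and hy: "act h y \<in> topspace Y"
    using flow h y unfolding is_flow_def by simp_all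
  obtain U U' where U: "openin Y U" "openin Y U'" "act h y \<in> U'" "y \<in> U" "disjnt U U'"
    using haus hy y unfolding Hausdorff_space_def by metis
  have "continuous_map Y ?P (\<lambda>z. (h, z))"
    using h by (simp add: continuous_map_pairwise o_def topspace_Aut_top)
  from continuous_map_compose[OF this cont] have "continuous_map Y Y (act h)"
    by (simp add: o_def)
  then have "openin Y {z \<in> topspace Y. act h z \<in> U'}"
    using U(2) unfolding continuous_map_def by blast
  then have V: "openin Y (U \<inter> {z \<in> topspace Y. act h z \<in> U'})" (is "openin Y ?V")
    using U(1) by blast
  have moved: "\<forall>z\<in>?V. act h z \<notin> ?V" using U(5) unfolding disjnt_def by blast
  let ?M = "{p \<in> topspace ?P. (\<lambda>(g, x). act g x) p \<in> ?V}"
  have "openin ?P ?M" using cont V unfolding continuous_map_def by blast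
  moreover have "(Aut_one D, y) \<in> ?M"
    using one y U(3,4) Aut_one_in by (simp add: topspace_Aut_top)
  ultimately have "\<exists>N W. openin (Aut_top D) N \<and> openin Y W \<and> Aut_one D \<in> N \<and> y \<in> W \<and> N \<times> W \<subseteq> ?M"
    by (rule openin_prod_topology_alt[THEN iffD1, rule_format])
  then obtain N W where NW: "openin (Aut_top D) N" "openin Y W" "Aut_one D \<in> N" "y \<in> W" "N \<times> W \<subseteq> ?M"
    by (elim exE conjE)
  obtain A where A: "finite A" "A \<subseteq> D" "\<forall>g\<in>Aut D. (\<forall>x\<in>A. g x = x) \<longrightarrow> g \<in> N"
    using Aut_top_stabilizer_subset[OF NW(1,3)] by (elim exE conjE)
  have "act g z \<in> ?V" if "g \<in> Aut D" "\<forall>x\<in>A. g x = x" "z \<in> W" for g z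
  proof -
    have "g \<in> N" using A(3) that(1,2) by simp
    with that(3) have "(g, z) \<in> N \<times> W" by simp
    then have "(g, z) \<in> ?M" by (rule subsetD[OF NW(5)])
    then show ?thesis by simp
  qed
  with moved NW(2,4) A(1,2) show ?thesis
    by (intro exI[of _ W] exI[of _ ?V] exI[of _ A] conjI ballI impI) simp_all
qed

text \<open>If every point is moved, a finite subcover by sets \<open>W j\<close> colours each copy
  \<open>f\<close> of \<open>A\<close> by some \<open>j\<close> for which an element of
  \<open>H\<close> undoing \<open>f\<close> on \<open>A\<close> sends \<open>y0\<close> into
  \<open>W j\<close>. Two copies of one colour that differ by the inverse of \<open>m j\<close> then
  put a point and its image under \<open>m j\<close> into \<open>V j\<close>.\<close>

lemma flow_fixed_point:
  assumes flow: "is_flow (Aut D) (Aut_mult D) (Aut_one D) (Aut_top D) Y act"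
    and ne: "topspace Y \<noteq> {}"
  shows "\<exists>y\<in>topspace Y. \<forall>h\<in>perm_aut D id. act h y = y"
proof (rule ccontr)
  let ?H = "perm_aut D id"
  have HG: "g \<in> Aut D" if "g \<in> ?H" for g using that perm_aut_subset[OF bij_id] by blast
  have act_in: "act g y \<in> topspace Y" if "g \<in> Aut D" "y \<in> topspace Y" for g y
    using flow that unfolding is_flow_def by simp
  have act_mult: "act (Aut_mult D g h) y = act g (act h y)"
    if "g \<in> Aut D" "h \<in> Aut D" "y \<in> topspace Y" for g h y
    using flow that unfolding is_flow_def by simp
  assume "\<not> (\<exists>y\<in>topspace Y. \<forall>h\<in>?H. act h y = y)"
  then have "\<forall>y. \<exists>h. y \<in> topspace Y \<longrightarrow> h \<in> ?H \<and> act h y \<noteq> y" by blast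
  from choice[OF this] obtain m where m: "\<And>y. y \<in> topspace Y \<Longrightarrow> m y \<in> ?H \<and> act (m y) y \<noteq> y"
    by blast
  have "\<forall>y. \<exists>q. y \<in> topspace Y \<longrightarrow> (case q of (W, V, A) \<Rightarrow>
      y \<in> W \<and> openin Y W \<and> finite A \<and> A \<subseteq> D \<and> (\<forall>z\<in>V. act (m y) z \<notin> V) \<and>
      (\<forall>g\<in>Aut D. (\<forall>x\<in>A. g x = x) \<longrightarrow> (\<forall>z\<in>W. act g z \<in> V)))"
    using flow_moved_nbhd[OF flow] m HG by simp
  from choice[OF this] obtain Q where Q: "\<And>y. y \<in> topspace Y \<Longrightarrow> (case Q y of (W, V, A) \<Rightarrow>
      y \<in> W \<and> openin Y W \<and> finite A \<and> A \<subseteq> D \<and> (\<forall>z\<in>V. act (m y) z \<notin> V) \<and>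
      (\<forall>g\<in>Aut D. (\<forall>x\<in>A. g x = x) \<longrightarrow> (\<forall>z\<in>W. act g z \<in> V)))"
    by blast
  define W where "W y = fst (Q y)" for y
  define V where "V y = fst (snd (Q y))" for y
  define A0 where "A0 y = snd (snd (Q y))" for y
  have W: "y \<in> W y" "openin Y (W y)" and A0: "finite (A0 y)" "A0 y \<subseteq> D"
    and V: "\<And>z. z \<in> V y \<Longrightarrow> act (m y) z \<notin> V y"
    and WV: "\<And>g z. g \<in> Aut D \<Longrightarrow> (\<And>x. x \<in> A0 y \<Longrightarrow> g x = x) \<Longrightarrow> z \<in> W y \<Longrightarrow> act g z \<in> V y"
    if "y \<in> topspace Y" for y
    using Q[OF that] unfolding W_def V_def A0_def by (simp_all add: case_prod_unfold)
  have "compact_space Y" using flow unfolding is_flow_def by simp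
  moreover have "\<forall>U\<in>W ` topspace Y. openin Y U" "topspace Y \<subseteq> \<Union>(W ` topspace Y)"
    using W by blast+
  ultimately obtain \<F> where "finite \<F>" "\<F> \<subseteq> W ` topspace Y" "topspace Y \<subseteq> \<Union>\<F>"
    unfolding compact_space_alt by meson
  then obtain J where J: "finite J" "J \<subseteq> topspace Y" "topspace Y \<subseteq> \<Union>(W ` J)"
    by (metis finite_subset_image)
  define A where "A = (\<Union>j\<in>J. A0 j)"
  have A: "finite A" "A \<subseteq> D" unfolding A_def using A0 J by blast+
  obtain y0 where y0: "y0 \<in> topspace Y" using ne by blast
  define P where "P f j \<longleftrightarrow> j \<in> J \<and> (\<exists>h\<in>?H. (\<forall>x\<in>A. h (f x) = x) \<and> act h y0 \<in> W j)" for f j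
  define col where "col f = (SOME j. P f j)" for f
  have P_col: "P f (col f)" if f: "f ` A \<subseteq> D" "coord_emb id A f" for f
    unfolding col_def
  proof (rule someI_ex)
    obtain k where k: "k \<in> ?H" "\<forall>x\<in>A. k x = f x" using back_and_forth[OF bij_id A f] by blast
    have "Aut_inv D k (f x) = x" if "x \<in> A" for x
    proof -
      have "x \<in> D" using A(2) that by blast
      then show ?thesis using Aut_inv_apply(3)[OF HG[OF k(1)], of x] k(2) that by simp
    qed
    moreover have "Aut_inv D k \<in> ?H" using k(1) by (rule perm_aut_id_inv)
    moreover from this have "act (Aut_inv D k) y0 \<in> topspace Y" using act_in HG y0 by blast
    then obtain j where "j \<in> J" "act (Aut_inv D k) y0 \<in> W j" using J(3) by blast
    ultimately show "\<exists>j. P f j" unfolding P_def by blast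
  qed
  \<comment> \<open>Let \<open>h\<close> be the element that witnesses the colour. Both
    \<open>g\<close> and \<open>h\<close> undo \<open>f\<close> on \<open>A\<close>, so
    \<open>g\<close> composed with the inverse of \<open>h\<close> fixes \<open>A\<close> pointwise
    and maps the point \<open>act h y0\<close> of \<open>W (col f)\<close> into
    \<open>V (col f)\<close>.\<close>
  have col_V: "act g y0 \<in> V (col f)"
    if f: "f ` A \<subseteq> D" "coord_emb id A f" and g: "g \<in> ?H" "\<And>x. x \<in> A \<Longrightarrow> g (f x) = x" for f g
  proof -
    obtain h where j: "col f \<in> J" and h: "h \<in> ?H" "\<And>x. x \<in> A \<Longrightarrow> h (f x) = x" "act h y0 \<in> W (col f)"
      using P_col[OF f] unfolding P_def by blast
    let ?s = "Aut_mult D g (Aut_inv D h)"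
    have s: "?s \<in> Aut D" using g(1) h(1) by (simp add: Aut_mult_in Aut_inv_in HG)
    have "?s x = x" if x: "x \<in> A" for x
    proof -
      have xD: "x \<in> D" "f x \<in> D" using A(2) x f(1) by blast+
      have "Aut_inv D h x = f x"
        using Aut_inv_apply(3)[OF HG[OF h(1)] xD(2)] h(2)[OF x] by simp
      then show ?thesis using xD(1) g(2)[OF x] by (simp add: Aut_mult_apply)
    qed
    then have "?s x = x" if "x \<in> A0 (col f)" for x using that j unfolding A_def by blast
    then have "act ?s (act h y0) \<in> V (col f)"
      using WV[of "col f" ?s "act h y0"] s h(3) j J(2) by blast
    moreover have "act ?s (act h y0) = act g y0"
      using act_mult[of g "Aut_inv D h" "act h y0"] Aut_flow_inv[OF flow HG[OF h(1)] y0]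
        HG g(1) h(1) y0 act_in Aut_inv_in by metis
    ultimately show ?thesis by simp
  qed
  \<comment> \<open>The common colour \<open>j\<close> is known only after the Ramsey step, so the
    inverses of all \<open>m j\<close> are included.\<close>
  define F where "F = insert id ((\<lambda>j. Aut_inv D (m j)) ` J)"
  have mH: "m j \<in> ?H" if "j \<in> J" for j using m that J(2) by blast
  have H_emb: "f ` A \<subseteq> D \<and> coord_emb id A f" if "f \<in> ?H" for f
    using that A(2) Aut_closed[OF HG[OF that]] unfolding perm_aut_def coord_emb_def by blast
  have F_emb: "f ` A \<subseteq> D \<and> coord_emb id A f" if "f \<in> F" for f
    using that A(2) H_emb[OF perm_aut_id_inv[OF mH]] unfolding F_def by (auto simp: coord_emb_def)
  have "\<exists>e\<in>?H. \<exists>j. \<forall>f\<in>F. col (e \<circ> f) = j"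
  proof (rule ramsey_embeddings[OF A])
    show "finite F" unfolding F_def using J(1) by simp
    show "col f \<in> J" if "f ` A \<subseteq> D" "coord_emb id A f" for f
      using P_col[OF that] unfolding P_def by blast
    show "col f = col f'" if eq: "\<And>x. x \<in> A \<Longrightarrow> f x = f' x" for f f'
    proof -
      have "P f = P f'" unfolding P_def using eq by (intro ext) simp
      then show ?thesis unfolding col_def by simp
    qed
  qed (use F_emb J(1) in blast)+
  then obtain e j where e: "e \<in> ?H" and j: "\<And>f. f \<in> F \<Longrightarrow> col (e \<circ> f) = j" by blast
  have e_emb: "(e \<circ> f) ` A \<subseteq> D" "coord_emb id A (e \<circ> f)" if "f \<in> F" for f
  proof -
    have "coord_emb id D e" using e unfolding perm_aut_def by blast
    moreover have "\<And>x. x \<in> A \<Longrightarrow> f x \<in> D" using F_emb[OF that] by blast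
    ultimately show "coord_emb id A (e \<circ> f)" "(e \<circ> f) ` A \<subseteq> D"
      using F_emb[OF that] Aut_closed[OF HG[OF e]] unfolding coord_emb_def by auto
  qed
  let ?g = "Aut_inv D e"
  have g: "?g \<in> ?H" using e by (rule perm_aut_id_inv)
  have ge: "?g (e x) = x" if "x \<in> D" for x using Aut_inv_apply(3)[OF HG[OF e] that] .
  have idF: "id \<in> F" unfolding F_def by simp
  have "act ?g y0 \<in> V (col (e \<circ> id))"
    by (rule col_V[OF e_emb[OF idF] g]) (use ge A(2) in auto)
  then have 1: "act ?g y0 \<in> V j" using j[OF idF] by simp
  have jJ: "j \<in> J"
    using P_col[OF e_emb[OF idF]] j[OF idF] unfolding P_def by simp
  let ?f = "Aut_inv D (m j)"
  have fF: "?f \<in> F" unfolding F_def using jJ by blast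
  have mj: "m j \<in> ?H" using mH[OF jJ] .
  \<comment> \<open>On \<open>A\<close> the copy \<open>e \<circ> ?f\<close> is undone by the
    inverse of \<open>e\<close> followed by \<open>m j\<close>.\<close>
  have "act (Aut_mult D (m j) ?g) y0 \<in> V (col (e \<circ> ?f))"
  proof (rule col_V[OF e_emb[OF fF] perm_aut_id_mult[OF mj g]])
    fix x assume "x \<in> A"
    then have x: "x \<in> D" using A(2) by blast
    have fx: "?f x \<in> D" "m j (?f x) = x" using Aut_inv_apply[OF HG[OF mj] x] by simp_all
    then show "Aut_mult D (m j) ?g ((e \<circ> ?f) x) = x"
      using ge[OF fx(1)] Aut_closed[OF HG[OF e] fx(1)] by (simp add: Aut_mult_apply)
  qed
  then have "act (m j) (act ?g y0) \<in> V j"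
    using j[OF fF] act_mult[OF HG[OF mj] HG[OF g] y0] by simp
  with V[OF _ 1] jJ J(2) show False by blast
qed

section \<open>The equivariant map onto an arbitrary minimal flow\<close>

lemma universal_map:
  assumes min: "is_minimal_flow (Aut D) (Aut_mult D) (Aut_one D) (Aut_top D) Y act"
  shows "\<exists>\<pi>. continuous_map (Rn_top D) Y \<pi> \<and> \<pi> ` topspace (Rn_top D) = topspace Y \<and>
    (\<forall>g\<in>Aut D. \<forall>r\<in>topspace (Rn_top D). \<pi> (logic_action D g r) = act g (\<pi> r))"
proof -
  have flow: "is_flow (Aut D) (Aut_mult D) (Aut_one D) (Aut_top D) Y act" and ne: "topspace Y \<noteq> {}"
    and dense: "\<And>y. y \<in> topspace Y \<Longrightarrow> Y closure_of ((\<lambda>g. act g y) ` Aut D) = topspace Y"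
    using min unfolding is_minimal_flow_def by simp_all
  have haus: "Hausdorff_space Y" using flow unfolding is_flow_def by simp
  have act_in: "act g y \<in> topspace Y" if "g \<in> Aut D" "y \<in> topspace Y" for g y
    using flow that unfolding is_flow_def by simp
  have act_mult: "act (Aut_mult D g h) y = act g (act h y)"
    if "g \<in> Aut D" "h \<in> Aut D" "y \<in> topspace Y" for g h y
    using flow that unfolding is_flow_def by simp
  obtain y0 where y0: "y0 \<in> topspace Y" "\<And>h. h \<in> perm_aut D id \<Longrightarrow> act h y0 = y0"
    using flow_fixed_point[OF flow ne] by blast
  let ?r0 = "perm_orders D id"
  have r0: "?r0 \<in> topspace (Rn_top D)"
    using perm_orders_in_Rn[OF bij_id] by (simp add: Rn_top_discrete)
  \<comment> \<open>The inverse of \<open>h\<close> composed with \<open>g\<close> fixes the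
    coordinate orders, so it lies in \<open>H\<close> and fixes \<open>y0\<close>.\<close>
  have welldef: "act g y0 = act h y0"
    if gh: "g \<in> Aut D" "h \<in> Aut D" and eq: "logic_action D g ?r0 = logic_action D h ?r0" for g h
  proof -
    let ?k = "Aut_mult D (Aut_inv D h) g"
    have k: "?k \<in> Aut D" using gh by (simp add: Aut_mult_in Aut_inv_in)
    have "logic_action D ?k ?r0 = ?r0"
      using logic_action_mult[OF Aut_inv_in[OF gh(2)] gh(1), of ?r0] eq
        Aut_flow_inv[OF logic_action_flow gh(2) r0] by simp
    then have "act ?k y0 = y0" by (intro y0 logic_action_fix_imp[OF k])
    then have "act (Aut_inv D h) (act g y0) = y0"
      using act_mult[OF Aut_inv_in[OF gh(2)] gh(1) y0(1)] by simp
    moreover have "act h (act (Aut_inv D h) (act g y0)) = act g y0"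
    proof -
      have "act h (act (Aut_inv D h) (act g y0)) = act (Aut_one D) (act g y0)"
        using act_mult[OF gh(2) Aut_inv_in[OF gh(2)] act_in[OF gh(1) y0(1)]] Aut_mult_inv(1)[OF gh(2)]
        by simp
      then show ?thesis using flow act_in[OF gh(1) y0(1)] unfolding is_flow_def by simp
    qed
    ultimately show ?thesis by simp
  qed
  have "\<forall>r. \<exists>g. r \<in> Rn D \<longrightarrow> g \<in> Aut D \<and> logic_action D g ?r0 = r"
    using logic_action_transitive by blast
  from choice[OF this] obtain \<gamma> where \<gamma>: "\<And>r. r \<in> Rn D \<Longrightarrow> \<gamma> r \<in> Aut D"
    "\<And>r. r \<in> Rn D \<Longrightarrow> logic_action D (\<gamma> r) ?r0 = r" by blast
  define \<pi> where "\<pi> r = act (\<gamma> r) y0" for r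
  have \<pi>_in: "\<pi> r \<in> topspace Y" if "r \<in> Rn D" for r
    unfolding \<pi>_def using act_in \<gamma>(1)[OF that] y0(1) by blast
  have equivariant: "\<pi> (logic_action D g r) = act g (\<pi> r)" if g: "g \<in> Aut D" and r: "r \<in> Rn D" for g r
  proof -
    have gr: "logic_action D g r \<in> Rn D" using g r by (rule logic_action_Rn)
    have "act (\<gamma> (logic_action D g r)) y0 = act (Aut_mult D g (\<gamma> r)) y0"
    proof (rule welldef)
      show "logic_action D (\<gamma> (logic_action D g r)) ?r0 = logic_action D (Aut_mult D g (\<gamma> r)) ?r0"
        using \<gamma>(2)[OF gr] \<gamma>(2)[OF r] logic_action_mult[OF g \<gamma>(1)[OF r]] by simp
    qed (use g \<gamma>(1) r gr Aut_mult_in in auto)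
    then show ?thesis unfolding \<pi>_def using act_mult[OF g \<gamma>(1)[OF r] y0(1)] by simp
  qed
  \<comment> \<open>The finite image is closed in a Hausdorff space and contains a dense orbit, so
    it is everything.\<close>
  have "closedin Y (\<pi> ` Rn D)"
    using haus finite_Rn \<pi>_in by (intro closedin_Hausdorff_finite) auto
  moreover have "(\<lambda>g. act g (\<pi> ?r0)) ` Aut D \<subseteq> \<pi> ` Rn D"
  proof (rule image_subsetI)
    fix g assume g: "g \<in> Aut D"
    have "act g (\<pi> ?r0) = \<pi> (logic_action D g ?r0)"
      using equivariant[OF g perm_orders_in_Rn[OF bij_id]] by simp
    moreover have "logic_action D g ?r0 \<in> Rn D"
      using g perm_orders_in_Rn[OF bij_id] by (rule logic_action_Rn)
    ultimately show "act g (\<pi> ?r0) \<in> \<pi> ` Rn D" by blast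
  qed
  ultimately have "topspace Y \<subseteq> \<pi> ` Rn D"
    using closure_of_minimal dense[OF \<pi>_in[OF perm_orders_in_Rn[OF bij_id]]] by metis
  then have "\<pi> ` Rn D = topspace Y" using \<pi>_in by blast
  moreover have "continuous_map (Rn_top D) Y \<pi>"
    using \<pi>_in by (simp add: Rn_top_discrete)
  ultimately show ?thesis
    using equivariant by (intro exI[of _ \<pi>]) (simp add: Rn_top_discrete)
qed

end

theorem theorem6p7:
  fixes D :: "('n::finite \<Rightarrow> rat) set"
  assumes "CARD('n) \<ge> 2"
    and "admissible_D D"
  shows "is_universal_minimal_flow TYPE('y) (Aut D) (Aut_mult D) (Aut_one D) (Aut_top D)
           (Rn_top D) (logic_action D)"
proof -
  interpret generic_dense D using assms(2) by (rule generic_dense_of_admissible)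
  show ?thesis
    unfolding is_universal_minimal_flow_def using logic_action_minimal universal_map by blast
qed

end
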